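(* Let $W$ be a simply laced Coxeter group and let $w\in W$. If the number of commutation classes of reduced expressions for $w$ equals $2^{N(w)}$, then $w$ is freely braided.
   Context: $W$ is a Coxeter group with generators $\{s_i : i\in I\}$ and Coxeter matrix $(m_{ij})$, simply laced meaning $m_{ij}\in\{2,3\}$ for $i\neq j$. Words are elements of the free monoid $I^*$; a word $i_1\cdots i_n$ represents $s_{i_1}\cdots s_{i_n}$, and is a reduced expression if $n$ is minimal. Let $V$ have basis $\{\alpha_i\}$ with symmetric bilinear form $B(\alpha_i,\alpha_j)=-\cos(\pi/m_{ij})$, and $W$ act by $s_i\alpha_j=\alpha_j-2B(\alpha_j,\alpha_i)\alpha_i$. The root system is $\Phi=\{w\alpha_i\}$, $\Phi^+$ the roots with nonnegative coefficients, $\Phi^-=-\Phi^+$. The inversion set is $\Phi(w)=\Phi^+\cap w^{-1}(\Phi^-)$. The root sequence of a reduced expression $i_1\cdots i_n$ is $(r_1,\dots,r_n)$ with $r_1=\alpha_{i_n}$ and $r_l=s_{i_n}\cdots s_{i_{n-l+2}}(\alpha_{i_{n-l+1}})$; these are the root sequences for $w$. An inversion triple of $w$ is a subset of $\Phi(w)$ of the form $\{\alpha,\beta,\alpha+\beta\}$; it is contractible if its elements appear consecutively (in some order) in some root sequence for $w$. $N(w)$ is the number of contractible inversion triples of $w$; $w$ is freely braided if its contractible inversion triples are pairwise disjoint. Two words are commutation equivalent if one is obtained from the other by a sequence of substitutions $\mathbf{u}ij\mathbf{v}\to\mathbf{u}ji\mathbf{v}$ with $m_{ij}=2$; the equivalence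 classes of reduced expressions for $w$ are its commutation classes. *)

theory Defs
  imports Complex_Main "HOL-Algebra.Group" "HOL-Library.Poly_Mapping"
begin

text \<open>The entry \<open>0\<close> of a Coxeter matrix stands for infinity.\<close>

definition coxeter_matrix :: "('i \<Rightarrow> 'i \<Rightarrow> nat) \<Rightarrow> bool" where
  "coxeter_matrix m \<longleftrightarrow>
     (\<forall>i. m i i = 1) \<and> (\<forall>i j. m i j = m j i) \<and> (\<forall>i j. i \<noteq> j \<longrightarrow> m i j \<noteq> 1)"

definition simply_laced :: "('i \<Rightarrow> 'i \<Rightarrow> nat) \<Rightarrow> bool" where
  "simply_laced m \<longleftrightarrow> (\<forall>i j. i \<noteq> j \<longrightarrow> m i j \<in> {2, 3})"

text \<open>
  The congruence on the free monoid generated by the Coxeter relators. The relators for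
  \<open>i = j\<close> already make every generator an involution, so the quotient monoid is the group
  with generators \<open>s\<^sub>i\<close> and relations that \<open>s\<^sub>i s\<^sub>j\<close> to the power \<open>m i j\<close> be trivial.
\<close>

inductive coxeter_cong :: "('i \<Rightarrow> 'i \<Rightarrow> nat) \<Rightarrow> 'i list \<Rightarrow> 'i list \<Rightarrow> bool"
  for m :: "'i \<Rightarrow> 'i \<Rightarrow> nat" where
  relator: "coxeter_cong m (concat (replicate (m i j) [i, j])) []"
| refl: "coxeter_cong m u u"
| sym: "coxeter_cong m u v \<Longrightarrow> coxeter_cong m v u"
| trans: "coxeter_cong m u v \<Longrightarrow> coxeter_cong m v w \<Longrightarrow> coxeter_cong m u w"
| ctxt: "coxeter_cong m u v \<Longrightarrow> coxeter_cong m (x @ u @ y) (x @ v @ y)"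

definition word_val :: "('g, 'b) monoid_scheme \<Rightarrow> ('i \<Rightarrow> 'g) \<Rightarrow> 'i list \<Rightarrow> 'g" where
  "word_val W s u = foldr (\<lambda>i g. s i \<otimes>\<^bsub>W\<^esub> g) u \<one>\<^bsub>W\<^esub>"

text \<open>The last two assumptions say that \<open>W\<close> is the group presented by the Coxeter relators.\<close>

locale coxeter_group = group W
  for W :: "('g, 'b) monoid_scheme" (structure)
    and s :: "'i \<Rightarrow> 'g"
    and m :: "'i \<Rightarrow> 'i \<Rightarrow> nat" +
  assumes matrix: "coxeter_matrix m"
    and gen_closed: "s i \<in> carrier W"
    and generated: "w \<in> carrier W \<Longrightarrow> \<exists>u. word_val W s u = w"
    and presented: "word_val W s u = word_val W s v \<longleftrightarrow> coxeter_cong m u v"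

definition reduced_expressions :: "('g, 'b) monoid_scheme \<Rightarrow> ('i \<Rightarrow> 'g) \<Rightarrow> 'g \<Rightarrow> 'i list set" where
  "reduced_expressions W s w =
     {u. word_val W s u = w \<and> (\<forall>v. word_val W s v = w \<longrightarrow> length u \<le> length v)}"

text \<open>The space \<open>V\<close> is the type of finitely supported real functions on the index type.\<close>

definition simple_root :: "'i \<Rightarrow> 'i \<Rightarrow>\<^sub>0 real" where
  "simple_root i = Poly_Mapping.single i 1"

text \<open>For \<open>m i j = 0\<close> the coefficient is \<open>- cos (pi / 0) = - 1\<close>, as usual for infinite order.\<close>

definition coxeter_form ::
    "('i \<Rightarrow> 'i \<Rightarrow> nat) \<Rightarrow> ('i \<Rightarrow>\<^sub>0 real) \<Rightarrow> ('i \<Rightarrow>\<^sub>0 real) \<Rightarrow> real" where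
  "coxeter_form m x y =
     (\<Sum>i\<in>Poly_Mapping.keys x. \<Sum>j\<in>Poly_Mapping.keys y.
        Poly_Mapping.lookup x i * Poly_Mapping.lookup y j * (- cos (pi / real (m i j))))"

text \<open>\<open>single i c\<close> is the multiple of the simple root of \<open>i\<close> by the scalar \<open>c\<close>.\<close>

definition simple_reflection ::
    "('i \<Rightarrow> 'i \<Rightarrow> nat) \<Rightarrow> 'i \<Rightarrow> ('i \<Rightarrow>\<^sub>0 real) \<Rightarrow> 'i \<Rightarrow>\<^sub>0 real" where
  "simple_reflection m i x = x - Poly_Mapping.single i (2 * coxeter_form m x (simple_root i))"

definition word_act ::
    "('i \<Rightarrow> 'i \<Rightarrow> nat) \<Rightarrow> 'i list \<Rightarrow> ('i \<Rightarrow>\<^sub>0 real) \<Rightarrow> 'i \<Rightarrow>\<^sub>0 real" where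
  "word_act m u = foldr (simple_reflection m) u"

text \<open>
  The action of \<open>w\<close> through an arbitrary word representing it; lemma \<open>act_word_val\<close> below shows
  that the choice of the word is immaterial.
\<close>

definition act ::
    "('g, 'b) monoid_scheme \<Rightarrow> ('i \<Rightarrow> 'g) \<Rightarrow> ('i \<Rightarrow> 'i \<Rightarrow> nat) \<Rightarrow> 'g \<Rightarrow> ('i \<Rightarrow>\<^sub>0 real) \<Rightarrow> 'i \<Rightarrow>\<^sub>0 real"
  where "act W s m w = word_act m (SOME u. word_val W s u = w)"

definition roots ::
    "('g, 'b) monoid_scheme \<Rightarrow> ('i \<Rightarrow> 'g) \<Rightarrow> ('i \<Rightarrow> 'i \<Rightarrow> nat) \<Rightarrow> ('i \<Rightarrow>\<^sub>0 real) set" where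
  "roots W s m = {act W s m w (simple_root i) | w i. w \<in> carrier W}"

definition pos_roots ::
    "('g, 'b) monoid_scheme \<Rightarrow> ('i \<Rightarrow> 'g) \<Rightarrow> ('i \<Rightarrow> 'i \<Rightarrow> nat) \<Rightarrow> ('i \<Rightarrow>\<^sub>0 real) set" where
  "pos_roots W s m = {x \<in> roots W s m. \<forall>i. 0 \<le> Poly_Mapping.lookup x i}"

definition neg_roots ::
    "('g, 'b) monoid_scheme \<Rightarrow> ('i \<Rightarrow> 'g) \<Rightarrow> ('i \<Rightarrow> 'i \<Rightarrow> nat) \<Rightarrow> ('i \<Rightarrow>\<^sub>0 real) set" where
  "neg_roots W s m = uminus ` pos_roots W s m"

definition inversion_set ::
    "('g, 'b) monoid_scheme \<Rightarrow> ('i \<Rightarrow> 'g) \<Rightarrow> ('i \<Rightarrow> 'i \<Rightarrow> nat) \<Rightarrow> 'g \<Rightarrow> ('i \<Rightarrow>\<^sub>0 real) set" where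
  "inversion_set W s m w = pos_roots W s m \<inter> act W s m (inv\<^bsub>W\<^esub> w) ` neg_roots W s m"

text \<open>
  With \<open>u = [i\<^sub>1, \<dots>, i\<^sub>n]\<close>, the entry at position \<open>l - 1\<close> is the simple root of
  \<open>i\<close> with index \<open>n - l + 1\<close>, acted upon by the last \<open>l - 1\<close> letters of \<open>u\<close> in reverse order.
\<close>

definition root_sequence :: "('i \<Rightarrow> 'i \<Rightarrow> nat) \<Rightarrow> 'i list \<Rightarrow> ('i \<Rightarrow>\<^sub>0 real) list" where
  "root_sequence m u =
     map (\<lambda>k. word_act m (take k (rev u)) (simple_root (rev u ! k))) [0..<length u]"

definition root_sequences ::
    "('g, 'b) monoid_scheme \<Rightarrow> ('i \<Rightarrow> 'g) \<Rightarrow> ('i \<Rightarrow> 'i \<Rightarrow> nat) \<Rightarrow> 'g \<Rightarrow> ('i \<Rightarrow>\<^sub>0 real) list set" where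
  "root_sequences W s m w = root_sequence m ` reduced_expressions W s w"

definition inversion_triples ::
    "('g, 'b) monoid_scheme \<Rightarrow> ('i \<Rightarrow> 'g) \<Rightarrow> ('i \<Rightarrow> 'i \<Rightarrow> nat) \<Rightarrow> 'g \<Rightarrow> ('i \<Rightarrow>\<^sub>0 real) set set" where
  "inversion_triples W s m w = {T. T \<subseteq> inversion_set W s m w \<and> (\<exists>a b. T = {a, b, a + b})}"

definition contractible_triples ::
    "('g, 'b) monoid_scheme \<Rightarrow> ('i \<Rightarrow> 'g) \<Rightarrow> ('i \<Rightarrow> 'i \<Rightarrow> nat) \<Rightarrow> 'g \<Rightarrow> ('i \<Rightarrow>\<^sub>0 real) set set" where
  "contractible_triples W s m w =
     {T \<in> inversion_triples W s m w.
        \<exists>r \<in> root_sequences W s m w. \<exists>xs x y z ys. r = xs @ [x, y, z] @ ys \<and> T = {x, y, z}}"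

definition num_contractible ::
    "('g, 'b) monoid_scheme \<Rightarrow> ('i \<Rightarrow> 'g) \<Rightarrow> ('i \<Rightarrow> 'i \<Rightarrow> nat) \<Rightarrow> 'g \<Rightarrow> nat" where
  "num_contractible W s m w = card (contractible_triples W s m w)"

definition freely_braided ::
    "('g, 'b) monoid_scheme \<Rightarrow> ('i \<Rightarrow> 'g) \<Rightarrow> ('i \<Rightarrow> 'i \<Rightarrow> nat) \<Rightarrow> 'g \<Rightarrow> bool" where
  "freely_braided W s m w \<longleftrightarrow> pairwise disjnt (contractible_triples W s m w)"

definition commutation_step :: "('i \<Rightarrow> 'i \<Rightarrow> nat) \<Rightarrow> ('i list \<times> 'i list) set" where
  "commutation_step m = {(x @ [i, j] @ y, x @ [j, i] @ y) | x y i j. m i j = 2}"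

definition commutation_classes ::
    "('g, 'b) monoid_scheme \<Rightarrow> ('i \<Rightarrow> 'g) \<Rightarrow> ('i \<Rightarrow> 'i \<Rightarrow> nat) \<Rightarrow> 'g \<Rightarrow> 'i list set set" where
  "commutation_classes W s m w = reduced_expressions W s w // (commutation_step m)\<^sup>*"


lemma coxeter_form_simple_root:
  "coxeter_form m x (simple_root i) =
     (\<Sum>j\<in>Poly_Mapping.keys x. Poly_Mapping.lookup x j * (- cos (pi / real (m j i))))"
  by (simp add: coxeter_form_def simple_root_def)

lemma coxeter_form_simple_root_superset:
  assumes "finite A" "Poly_Mapping.keys x \<subseteq> A"
  shows "coxeter_form m x (simple_root i) =
     (\<Sum>j\<in>A. Poly_Mapping.lookup x j * (- cos (pi / real (m j i))))"
  unfolding coxeter_form_simple_root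
  by (rule sum.mono_neutral_left) (use assms in \<open>auto simp: in_keys_iff\<close>)

lemma coxeter_form_diff:
  "coxeter_form m (x - y) (simple_root i) =
     coxeter_form m x (simple_root i) - coxeter_form m y (simple_root i)"
proof -
  let ?A = "Poly_Mapping.keys x \<union> Poly_Mapping.keys y"
  have "Poly_Mapping.keys (x - y) \<subseteq> ?A"
    by (auto simp: in_keys_iff lookup_minus)
  then show ?thesis
    by (simp add: coxeter_form_simple_root_superset[of ?A] lookup_minus
        left_diff_distrib sum_subtractf sum_negf)
qed

lemma coxeter_form_single:
  "coxeter_form m (Poly_Mapping.single j c) (simple_root i) = - c * cos (pi / real (m j i))"
  by (simp add: coxeter_form_simple_root)

lemma word_act_relator:
  assumes "coxeter_matrix m" "simply_laced m"
  shows "word_act m (concat (replicate (m i j) [i, j])) x = x"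
proof -
  have diag: "m i i = 1" for i
    using assms(1) by (simp add: coxeter_matrix_def)
  have symm: "m j i = m i j"
    using assms(1) by (simp add: coxeter_matrix_def)
  consider "i = j" | "i \<noteq> j" "m i j = 2" | "i \<noteq> j" "m i j = 3"
    using assms(2) by (auto simp: simply_laced_def)
  then show ?thesis
  proof cases
    case 1
    then show ?thesis
      by (simp add: word_act_def simple_reflection_def coxeter_form_diff coxeter_form_single diag
          single_uminus)
  next
    case 2
    have "replicate 2 [i, j] = [[i, j], [i, j]]"
      by (simp add: numeral_2_eq_2)
    with 2 show ?thesis
      by (simp add: word_act_def simple_reflection_def coxeter_form_diff coxeter_form_single
          diag symm single_uminus)
  next
    case 3
    have "replicate 3 [i, j] = [[i, j], [i, j], [i, j]]"
      by (simp add: numeral_3_eq_3)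
    with 3 show ?thesis
      by (intro poly_mapping_eqI)
        (simp add: word_act_def simple_reflection_def coxeter_form_diff coxeter_form_single
          diag symm cos_60 lookup_minus lookup_single when_def,
          auto simp: field_simps)
  qed
qed

lemma word_act_cong:
  assumes "coxeter_matrix m" "simply_laced m" "coxeter_cong m u v"
  shows "word_act m u = word_act m v"
  using assms(3)
proof induction
  case (relator i j)
  then show ?case
    using word_act_relator[OF assms(1,2)] by (simp add: fun_eq_iff) (simp add: word_act_def)
qed (simp_all add: word_act_def)

lemma act_word_val:
  assumes "coxeter_group W s m" "simply_laced m"
  shows "act W s m (word_val W s u) = word_act m u"
proof -
  interpret coxeter_group W s m by fact
  have "word_val W s (SOME v. word_val W s v = word_val W s u) = word_val W s u"
    by (rule someI[where x = u]) simp
  then show ?thesis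
    unfolding act_def using word_act_cong[OF matrix assms(2)] presented by blast
qed

end

theory Submission imports Defs begin

text \<open>
  Swapping two commuting letters exchanges two adjacent orthogonal roots of the root sequence,
  so the order of two non-orthogonal roots is an invariant of the commutation class; in
  particular each class orients every inversion triple \<open>{a, b, a + b}\<close>, whose middle element is
  always \<open>a + b\<close>. By Matsumoto's theorem a triple with two possible orientations is contractible,
  and sorting one root sequence towards another shows that classes with the same orientations
  coincide. Hence there are at most \<open>2\<^sup>N\<close> classes, and in the case of equality every choice of
  orientations of the contractible triples occurs.

  In that case take any class and any contractible triple \<open>T\<close>, and compare with the class that
  differs in the orientation of \<open>T\<close> only: the sorting argument makes \<open>T\<close> consecutive in some
  member of the given class. If two distinct contractible triples shared a root, then
  orienting them suitably, two different roots would both directly follow the common one in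
  sequences of the same class, and hence be orthogonal. Varying the orientations yields enough
  orthogonalities to contradict \<open>B a (a + b) = 1 / 2\<close>.
\<close>

section \<open>The bilinear form and the reflections\<close>

lemma coxeter_form_superset:
  assumes "finite A" "Poly_Mapping.keys x \<subseteq> A" "Poly_Mapping.keys y \<subseteq> A"
  shows "coxeter_form m x y =
     (\<Sum>i\<in>A. \<Sum>j\<in>A.
        Poly_Mapping.lookup x i * Poly_Mapping.lookup y j * (- cos (pi / real (m i j))))"
proof -
  have "coxeter_form m x y = (\<Sum>i\<in>Poly_Mapping.keys x. \<Sum>j\<in>A.
        Poly_Mapping.lookup x i * Poly_Mapping.lookup y j * (- cos (pi / real (m i j))))"
    unfolding coxeter_form_def
    by (intro sum.cong refl sum.mono_neutral_left) (use assms in \<open>auto simp: in_keys_iff\<close>)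
  also have "\<dots> = (\<Sum>i\<in>A. \<Sum>j\<in>A.
        Poly_Mapping.lookup x i * Poly_Mapping.lookup y j * (- cos (pi / real (m i j))))"
    by (intro sum.mono_neutral_left) (use assms in \<open>auto simp: in_keys_iff\<close>)
  finally show ?thesis .
qed

lemma coxeter_form_add_left:
  "coxeter_form m (x + y) z = coxeter_form m x z + coxeter_form m y z"
proof -
  let ?A = "Poly_Mapping.keys x \<union> Poly_Mapping.keys y \<union> Poly_Mapping.keys z"
  have "Poly_Mapping.keys (x + y) \<subseteq> ?A"
    using Poly_Mapping.keys_add by fastforce
  moreover have "Poly_Mapping.keys x \<subseteq> ?A" "Poly_Mapping.keys y \<subseteq> ?A" "Poly_Mapping.keys z \<subseteq> ?A"
    by auto
  ultimately show ?thesis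
    by (simp add: coxeter_form_superset[of ?A] lookup_add distrib_right sum.distrib
        flip: sum_negf)
      (simp add: algebra_simps sum.distrib sum_negf sum_subtractf)
qed

lemma coxeter_form_single_left:
  "coxeter_form m (Poly_Mapping.single i c) y = c * coxeter_form m (simple_root i) y"
  by (cases "c = 0")
    (simp_all add: coxeter_form_def simple_root_def sum_distrib_left mult.assoc flip: sum_negf)

section \<open>Relative position in a list\<close>

fun before :: "'a list \<Rightarrow> 'a \<Rightarrow> 'a \<Rightarrow> bool" where
  "before [] a b \<longleftrightarrow> False"
| "before (x # L) a b \<longleftrightarrow> a = x \<and> b \<in> set L \<or> before L a b"

lemma before_append:
  "before (P @ Q) a b \<longleftrightarrow> before P a b \<or> before Q a b \<or> a \<in> set P \<and> b \<in> set Q"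
  by (induction P) auto

lemma before_set: "before L a b \<Longrightarrow> a \<in> set L" "before L a b \<Longrightarrow> b \<in> set L"
  by (induction L) auto

lemma before_asym: "distinct L \<Longrightarrow> before L a b \<Longrightarrow> \<not> before L b a"
  by (induction L) (auto dest: before_set)

lemma before_neq: "distinct L \<Longrightarrow> before L a b \<Longrightarrow> a \<noteq> b"
  using before_asym by fastforce

lemma before_total: "a \<in> set L \<Longrightarrow> b \<in> set L \<Longrightarrow> a \<noteq> b \<Longrightarrow> before L a b \<or> before L b a"
  by (induction L) auto

lemma before_trans: "distinct L \<Longrightarrow> before L a b \<Longrightarrow> before L b c \<Longrightarrow> before L a c"
  by (induction L) (auto dest: before_set)

lemma before_splitL:
  assumes "before L a b"
  obtains P Q where "L = P @ a # Q" "b \<in> set Q"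
proof -
  have "\<exists>P Q. L = P @ a # Q \<and> b \<in> set Q"
    using assms
  proof (induction L)
    case (Cons x L)
    then show ?case by (metis append_Cons append_Nil before.simps(2))
  qed simp
  then show ?thesis using that by blast
qed

lemma before_split:
  assumes "before L a b"
  obtains P M Q where "L = P @ a # M @ b # Q"
  using before_splitL[OF assms] by (metis in_set_conv_decomp)

lemma list_eq_if_before:
  assumes "distinct L" "distinct R" "set L = set R"
    and "\<And>a b. before L a b \<Longrightarrow> before R a b"
  shows "L = R"
  using assms
proof (induction L arbitrary: R)
  case (Cons x L)
  then obtain y R' where R: "R = y # R'" by (cases R) auto
  have "x = y"
  proof (rule ccontr)
    assume "x \<noteq> y"
    have "y \<in> set (x # L)" "x \<in> set R"
      by (metis Cons.prems(3) R list.set_intros(1))+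
    with \<open>x \<noteq> y\<close> have "before (x # L) x y" "before R y x"
      by (simp_all add: R)
    then show False using before_asym[OF Cons.prems(2)] Cons.prems(4)[of x y] by simp
  qed
  moreover have "L = R'"
  proof (rule Cons.IH)
    show "before R' a b" if "before L a b" for a b
      using Cons.prems(1) Cons.prems(4)[of a b] that before_set[OF that] R \<open>x = y\<close> by auto
    show "set L = set R'"
      using Cons.prems(1-3) R \<open>x = y\<close> by (metis Diff_insert_absorb distinct.simps(2) list.simps(15))
  qed (use Cons.prems(1,2) R in auto)
  ultimately show ?case using R by simp
qed simp

text \<open>Walk from \<open>x\<close> towards \<open>y\<close>: if the next entry \<open>p\<close>
  precedes \<open>x\<close> in \<open>R\<close>, the pair \<open>x, p\<close> serves; otherwise
  transitivity makes \<open>p, y\<close> an inversion with a shorter gap. The final inclusion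
  records that the pair lies in the stretch from \<open>x\<close> to \<open>y\<close>.\<close>

lemma adjacent_inversion:
  assumes "distinct R" "distinct L" "set L = set R"
    and "L = P @ x # M @ y # Q" "before R y x"
  shows "\<exists>P' p q Q'. L = P' @ [p, q] @ Q' \<and> before R q p \<and> {p, q} \<subseteq> insert x (insert y (set M))"
  using assms(4,5)
proof (induction M arbitrary: P x)
  case Nil
  then show ?case by (intro exI[of _ P] exI[of _ x] exI[of _ y] exI[of _ Q]) auto
next
  case (Cons p M)
  show ?case
  proof (cases "before R p x")
    case True
    then show ?thesis
      using Cons.prems(1) by (intro exI[of _ P] exI[of _ x] exI[of _ p] exI[of _ "M @ y # Q"]) auto
  next
    case False
    have "x \<noteq> p" "x \<in> set R" "p \<in> set R"
      using Cons.prems(1) assms(2) unfolding assms(3)[symmetric] by auto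
    then have "before R x p" using False before_total by metis
    then have "before R y p" using Cons.prems(2) assms(1) before_trans by metis
    with Cons.IH[of "P @ [x]" p] Cons.prems(1) show ?thesis by fastforce
  qed
qed

section \<open>Form, reflections and word action for a simply laced matrix\<close>

locale simply_laced_matrix =
  fixes m :: "'i \<Rightarrow> 'i \<Rightarrow> nat"
  assumes matrix: "coxeter_matrix m" and laced: "simply_laced m"
begin

abbreviation B :: "('i \<Rightarrow>\<^sub>0 real) \<Rightarrow> ('i \<Rightarrow>\<^sub>0 real) \<Rightarrow> real" where
  "B \<equiv> coxeter_form m"

lemma diag [simp]: "m i i = 1"
  using matrix by (simp add: coxeter_matrix_def)

lemma m_sym: "m i j = m j i"
  using matrix by (simp add: coxeter_matrix_def)

lemma m_cases: "i \<noteq> j \<Longrightarrow> m i j = 2 \<or> m i j = 3"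
  using laced by (auto simp: simply_laced_def)

lemma form_sym: "B x y = B y x"
  unfolding coxeter_form_def by (subst sum.swap) (simp add: m_sym mult.commute)

lemma form_add_right: "B z (x + y) = B z x + B z y"
  by (metis coxeter_form_add_left form_sym)

lemma form_diff_left: "B (x - y) z = B x z - B y z"
  using coxeter_form_add_left[of m "x - y" y z] by simp

lemma form_diff_right: "B z (x - y) = B z x - B z y"
  by (metis form_diff_left form_sym)

lemma form_single_right: "B x (Poly_Mapping.single i c) = c * B x (simple_root i)"
  by (metis coxeter_form_single_left form_sym)

lemma form_simple_roots:
  "B (simple_root i) (simple_root j) = (if i = j then 1 else if m i j = 2 then 0 else - 1 / 2)"
  using m_cases[of i j] by (auto simp: coxeter_form_def simple_root_def cos_60)

lemmas form_linear =
  coxeter_form_add_left form_add_right form_diff_left form_diff_right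
  coxeter_form_single_left form_single_right

lemma reflection_isometry: "B (simple_reflection m i x) (simple_reflection m i y) = B x y"
  unfolding simple_reflection_def
  by (simp add: form_linear form_simple_roots form_sym[of "simple_root i"])

lemma reflection_add: "simple_reflection m i (x + y) = simple_reflection m i x + simple_reflection m i y"
  unfolding simple_reflection_def
  by (simp add: form_linear distrib_left single_add)

lemma word_act_Nil [simp]: "word_act m [] = id"
  by (auto simp: word_act_def)

lemma word_act_Cons [simp]: "word_act m (i # u) x = simple_reflection m i (word_act m u x)"
  by (simp add: word_act_def)

lemma word_act_append [simp]: "word_act m (u @ v) x = word_act m u (word_act m v x)"
  by (simp add: word_act_def)

lemma word_act_add: "word_act m u (x + y) = word_act m u x + word_act m u y"
  by (induction u) (auto simp: reflection_add)

lemma word_act_diff: "word_act m u (x - y) = word_act m u x - word_act m u y"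
  using word_act_add[of u "x - y" y] by (simp add: algebra_simps)

lemma word_act_0 [simp]: "word_act m u 0 = 0"
  using word_act_diff[of u 0 0] by simp

lemma word_act_minus: "word_act m u (- x) = - word_act m u x"
  using word_act_diff[of u 0 x] by simp

lemma reflection_simple:
  "simple_reflection m i (simple_root j) =
    (if i = j then - simple_root i
     else if m i j = 2 then simple_root j else simple_root j + simple_root i)"
  unfolding simple_reflection_def form_simple_roots using m_sym[of i j]
  by (auto simp: simple_root_def single_uminus simp flip: single_add single_diff)

lemma word_act_isometry: "B (word_act m u x) (word_act m u y) = B x y"
  by (induction u) (auto simp: reflection_isometry)

lemma reflection_involution [simp]: "simple_reflection m i (simple_reflection m i x) = x"
  using word_act_relator[OF matrix laced, of i i x] by simp

lemma word_act_rev [simp]: "word_act m (rev u) (word_act m u x) = x"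
  by (induction u arbitrary: x) auto

lemma word_act_rev' [simp]: "word_act m u (word_act m (rev u) x) = x"
  by (metis rev_rev_ident word_act_rev)

section \<open>Words and length\<close>

abbreviation cong :: "'i list \<Rightarrow> 'i list \<Rightarrow> bool" (infix "\<approx>" 50) where
  "u \<approx> v \<equiv> coxeter_cong m u v"

lemma cong_append: "u \<approx> u' \<Longrightarrow> v \<approx> v' \<Longrightarrow> u @ v \<approx> u' @ v'"
  using coxeter_cong.ctxt[of m u u' "[]" v] coxeter_cong.ctxt[of m v v' u' "[]"]
  by (auto intro: coxeter_cong.trans)

lemmas cong_appendL = cong_append[OF coxeter_cong.refl]
  and cong_appendR = cong_append[OF _ coxeter_cong.refl]

lemma cong_double: "[i, i] \<approx> []"
  using coxeter_cong.relator[of m i i] by simp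

lemma cong_cancel_letter: "u @ [i, i] @ v \<approx> u @ v"
  using coxeter_cong.ctxt[OF cong_double, of u i v] by simp

lemma cong_snoc_cancel: "u @ [i] \<approx> v @ [i] \<Longrightarrow> u \<approx> v"
  using cong_appendR[of "u @ [i]" "v @ [i]" "[i]"] cong_cancel_letter[of u i "[]"]
    cong_cancel_letter[of v i "[]"]
  by (auto intro: coxeter_cong.trans coxeter_cong.sym)

lemma cong_snoc_move: "u @ [i] \<approx> v \<Longrightarrow> u \<approx> v @ [i]"
  by (rule cong_snoc_cancel[of _ i])
    (use cong_cancel_letter[of v i "[]"] in \<open>auto intro: coxeter_cong.trans coxeter_cong.sym\<close>)

lemma cong_commute:
  assumes "m i j = 2"
  shows "[i, j] \<approx> [j, i]"
proof -
  have "[i, j, i, j] \<approx> []"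
    using coxeter_cong.relator[of m i j] assms by (simp add: numeral_2_eq_2)
  then have "[i, j, i] \<approx> [j]"
    using cong_snoc_move[of "[i, j, i]" j "[]"] by simp
  then show ?thesis
    using cong_snoc_move[of "[i, j]" i "[j]"] by simp
qed

lemma cong_braid:
  assumes "m i j = 3"
  shows "[i, j, i] \<approx> [j, i, j]"
proof -
  have "[i, j, i, j, i, j] \<approx> []"
    using coxeter_cong.relator[of m i j] assms by (simp add: numeral_3_eq_3)
  then have "[i, j, i, j, i] \<approx> [j]"
    using cong_snoc_move[of "[i, j, i, j, i]" j "[]"] by simp
  then have "[i, j, i, j] \<approx> [j, i]"
    using cong_snoc_move[of "[i, j, i, j]" i "[j]"] by simp
  then show ?thesis
    using cong_snoc_move[of "[i, j, i]" j "[j, i]"] by simp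
qed

text \<open>All relators have even length. This is the sign character; it ensures that one more
  letter always changes \<open>len\<close>.\<close>

lemma cong_parity: "u \<approx> v \<Longrightarrow> even (length u) \<longleftrightarrow> even (length v)"
proof (induction rule: coxeter_cong.induct)
  case (relator i j)
  have "length (concat (replicate n [i, j])) = 2 * n" for n
    by (induction n) auto
  then show ?case by simp
qed auto

text \<open>Reversal, which is inversion in the group, turns the relator of \<open>i, j\<close> into
  that of \<open>j, i\<close>.\<close>

lemma cong_rev: "u \<approx> v \<Longrightarrow> rev u \<approx> rev v"
proof (induction rule: coxeter_cong.induct)
  case (relator i j)
  have *: "concat (replicate n xs) @ xs = xs @ concat (replicate n xs)" for n and xs :: "'i list"
    by (induction n) auto
  have "rev (concat (replicate n [i, j])) = concat (replicate n [j, i])" for n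
    by (induction n) (use *[of _ "[j, i]"] in auto)
  then show ?case
    using coxeter_cong.relator[of m j i] by (simp add: m_sym)
next
  case (ctxt u v x y)
  then show ?case using cong_appendL[OF cong_appendR] by simp
qed (blast intro: coxeter_cong.intros)+

lemma word_act_eq_if_cong: "u \<approx> v \<Longrightarrow> word_act m u = word_act m v"
  by (rule word_act_cong[OF matrix laced])

text \<open>The Coxeter length of the represented element, formulated for words so that the argument
  stays independent of the group until the last section.\<close>

definition len :: "'i list \<Rightarrow> nat" where
  "len u = (LEAST n. \<exists>v. u \<approx> v \<and> length v = n)"

definition reduced :: "'i list \<Rightarrow> bool" where
  "reduced u \<longleftrightarrow> len u = length u"

lemma len_le: "u \<approx> v \<Longrightarrow> len u \<le> length v"
  unfolding len_def by (rule Least_le) auto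

lemma obtain_len:
  obtains v where "u \<approx> v" "length v = len u"
proof -
  have "\<exists>v. u \<approx> v \<and> length v = len u"
    unfolding len_def by (rule LeastI[of _ "length u"]) (auto intro: coxeter_cong.refl)
  then show ?thesis using that by blast
qed

lemma len_cong: "u \<approx> v \<Longrightarrow> len u = len v"
  by (metis coxeter_cong.sym coxeter_cong.trans dual_order.antisym len_le obtain_len)

lemma obtain_reduced:
  obtains v where "u \<approx> v" "reduced v" "length v = len u"
  using obtain_len[of u] len_cong unfolding reduced_def by metis

lemma reduced_iff: "reduced u \<longleftrightarrow> (\<forall>v. u \<approx> v \<longrightarrow> length u \<le> length v)"
  unfolding reduced_def
  by (metis coxeter_cong.refl dual_order.antisym len_le obtain_len)

lemma len_snoc_le: "len (u @ [i]) \<le> len u + 1"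
  by (metis cong_appendR len_le length_append_singleton obtain_len Suc_eq_plus1)

lemma len_snoc_snoc: "len (u @ [i, i]) = len u"
  using len_cong[OF cong_cancel_letter[of u i "[]"]] by simp

lemma len_snoc_ge: "len u \<le> len (u @ [i]) + 1"
  using len_snoc_le[of "u @ [i]" i] by (simp add: len_snoc_snoc)

lemma len_snoc_neq: "len (u @ [i]) \<noteq> len u"
proof -
  obtain v where v: "u \<approx> v" "length v = len u" by (rule obtain_len)
  obtain x where x: "u @ [i] \<approx> x" "length x = len (u @ [i])" by (rule obtain_len)
  show ?thesis
    using cong_parity[OF v(1)] cong_parity[OF x(1)] v(2) x(2) by auto
qed

lemma len_snoc_cases: "len (u @ [i]) = len u + 1 \<or> len u = len (u @ [i]) + 1"
  using len_snoc_le[of u i] len_snoc_ge[of u i] len_snoc_neq[of u i] by linarith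

lemma reduced_appendD:
  assumes "reduced (u @ v)"
  shows "reduced u" "reduced v"
proof -
  show "reduced u"
    unfolding reduced_iff
  proof (intro allI impI)
    fix u' assume "u \<approx> u'"
    then have "u @ v \<approx> u' @ v" by (rule cong_appendR)
    with assms show "length u \<le> length u'" unfolding reduced_iff by fastforce
  qed
  show "reduced v"
    unfolding reduced_iff
  proof (intro allI impI)
    fix v' assume "v \<approx> v'"
    then have "u @ v \<approx> u @ v'" by (rule cong_appendL)
    with assms show "length v \<le> length v'" unfolding reduced_iff by fastforce
  qed
qed

lemma reduced_rev: "reduced (rev u) \<longleftrightarrow> reduced u"
  unfolding reduced_iff by (metis cong_rev length_rev rev_rev_ident)

lemma reduced_cong: "reduced u \<Longrightarrow> u \<approx> v \<Longrightarrow> length v = length u \<Longrightarrow> reduced v"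
  unfolding reduced_def using len_cong by metis

lemma reduced_length: "reduced u \<Longrightarrow> reduced v \<Longrightarrow> u \<approx> v \<Longrightarrow> length u = length v"
  unfolding reduced_def using len_cong by metis

section \<open>Positive roots\<close>

definition nonneg :: "('i \<Rightarrow>\<^sub>0 real) \<Rightarrow> bool" where
  "nonneg x \<longleftrightarrow> (\<forall>i. 0 \<le> Poly_Mapping.lookup x i)"

definition root :: "('i \<Rightarrow>\<^sub>0 real) \<Rightarrow> bool" where
  "root x \<longleftrightarrow> (\<exists>u i. x = word_act m u (simple_root i))"

lemma nonneg_add: "nonneg x \<Longrightarrow> nonneg y \<Longrightarrow> nonneg (x + y)"
  by (simp add: nonneg_def lookup_add)

lemma nonneg_simple: "nonneg (simple_root i)"
  by (simp add: nonneg_def simple_root_def lookup_single when_def)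

lemma nonneg_antisym: "nonneg x \<Longrightarrow> nonneg (- x) \<Longrightarrow> x = 0"
  by (intro poly_mapping_eqI) (simp add: nonneg_def lookup_uminus order_antisym)

text \<open>The classical argument descends to the cosets of a dihedral parabolic subgroup; in the
  simply laced case these have at most six elements and the descent is explicit.\<close>

lemma nonneg_ascent: "len u < len (u @ [i]) \<Longrightarrow> nonneg (word_act m u (simple_root i))"
proof (induction "len u" arbitrary: u i rule: less_induct)
  case less
  obtain v where v: "u \<approx> v" "reduced v" "length v = len u" by (rule obtain_reduced)
  have act: "word_act m u = word_act m v" by (rule word_act_eq_if_cong[OF v(1)])
  show ?case
  proof (cases v rule: rev_cases)
    case Nil
    then show ?thesis by (simp add: act nonneg_simple)
  next
    case (snoc x t)
    have lv: "len v = len u" using v(1) len_cong by metis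
    have lvi: "len (v @ [i]) = len u + 1"
      using len_cong[OF cong_appendR[OF v(1), of "[i]"]] less.prems len_snoc_cases[of u i] by simp
    have lx: "len x + 1 = len u"
      using v(2,3) reduced_appendD(1)[of x "[t]"] unfolding snoc reduced_def by simp
    have "t \<noteq> i"
      using lvi len_snoc_snoc[of x t] lx snoc by auto
    have xt: "len (x @ [t]) = len x + 1" using lv lx snoc by simp
    have xti: "len (x @ [t, i]) = len x + 2" using lvi lx snoc by simp
    have IH: "nonneg (word_act m y (simple_root j))" if "len y < len u" "len y < len (y @ [j])" for y j
      using less.hyps that by blast
    from m_cases[OF \<open>t \<noteq> i\<close>] show ?thesis
    proof
      assume m2: "m t i = 2"
      have "len (x @ [t, i]) = len (x @ [i, t])"
        by (rule len_cong[OF cong_appendL[OF cong_commute[OF m2]]])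
      then have "len x < len (x @ [i])"
        using xti len_snoc_le[of "x @ [i]" t] by simp
      then have "nonneg (word_act m x (simple_root i))"
        using IH[of x i] lx by simp
      then show ?thesis
        using m2 \<open>t \<noteq> i\<close> by (simp add: act snoc reflection_simple)
    next
      assume m3: "m t i = 3"
      have eq: "word_act m u (simple_root i) = word_act m x (simple_root i) + word_act m x (simple_root t)"
        using m3 \<open>t \<noteq> i\<close> by (simp add: act snoc reflection_simple word_act_add)
      show ?thesis
      proof (cases "len x < len (x @ [i])")
        case True
        then show ?thesis
          using IH[of x i] IH[of x t] lx xt by (simp add: eq nonneg_add)
      next
        case False
        \<comment> \<open>Now \<open>i\<close> shortens \<open>x\<close>. In terms of
          \<open>y\<close>, the sum of the two images is the image of the simple root of
          \<open>t\<close>, and the braid relation shows that \<open>t\<close> lengthens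
          \<open>y\<close>.\<close>
        define y where "y = x @ [i]"
        have ly: "len y + 1 = len x"
          using False len_snoc_cases[of x i] by (simp add: y_def)
        have "len (x @ [i, t, i]) = len (x @ [t, i, t])"
          by (rule len_cong[OF cong_appendL[OF coxeter_cong.sym[OF cong_braid[OF m3]]]])
        then have "len (y @ [t]) + 1 \<ge> len (x @ [t, i, t])"
          using len_snoc_le[of "x @ [i, t]" i] by (simp add: y_def)
        moreover have "len (x @ [t, i, t]) + 1 \<ge> len x + 2"
          using len_snoc_ge[of "x @ [t, i]" t] xti by simp
        ultimately have "len y < len (y @ [t])" using ly by simp
        then have "nonneg (word_act m y (simple_root t))"
          using IH[of y t] lx ly by simp
        then show ?thesis
          using m3 \<open>t \<noteq> i\<close> m_sym[of t i] by (simp add: eq y_def reflection_simple word_act_add add.commute)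
      qed
    qed
  qed
qed

lemma nonneg_descent:
  assumes "len (u @ [i]) < len u"
  shows "nonneg (- word_act m u (simple_root i))"
  using nonneg_ascent[of "u @ [i]" i] assms
  by (simp add: len_snoc_snoc reflection_simple word_act_minus)

lemma root_simple: "root (simple_root i)"
  unfolding root_def by (rule exI[of _ "[]"]) auto

lemma root_act: "root x \<Longrightarrow> root (word_act m u x)"
  unfolding root_def by (metis word_act_append)

lemma root_act_iff: "root (word_act m u x) \<longleftrightarrow> root x"
  by (metis root_act word_act_rev)

lemma root_uminus: "root x \<Longrightarrow> root (- x)"
proof -
  assume "root x"
  then obtain u i where "x = word_act m u (simple_root i)" by (auto simp: root_def)
  then have "- x = word_act m (u @ [i]) (simple_root i)"
    by (simp add: reflection_simple word_act_minus)
  then show ?thesis unfolding root_def by blast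
qed

lemma root_norm: "root x \<Longrightarrow> B x x = 1"
  by (auto simp: root_def word_act_isometry form_simple_roots)

lemma root_nonzero: "root x \<Longrightarrow> x \<noteq> 0"
  using root_norm[of x] form_diff_left[of x x x] by auto

lemma root_sign: "root x \<Longrightarrow> nonneg x \<or> nonneg (- x)"
  unfolding root_def using nonneg_ascent nonneg_descent len_snoc_neq by (metis linorder_neqE_nat)

lemma root_not_both: "root x \<Longrightarrow> nonneg x \<Longrightarrow> \<not> nonneg (- x)"
  using nonneg_antisym root_nonzero by blast

lemma ascent_iff: "nonneg (word_act m u (simple_root i)) \<longleftrightarrow> len u < len (u @ [i])"
  using nonneg_ascent nonneg_descent root_not_both root_act[OF root_simple] len_snoc_neq
  by (metis linorder_neqE_nat)

text \<open>The reflection alters only coordinate \<open>i\<close>, so all other coordinates must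
  vanish; the norm \<open>1\<close> and the sign fix the remaining one.\<close>

lemma sign_change:
  assumes "root x" "nonneg x" "nonneg (- simple_reflection m i x)"
  shows "x = simple_root i"
proof -
  define c where "c = Poly_Mapping.lookup x i"
  have "Poly_Mapping.lookup x j = 0" if "j \<noteq> i" for j
    using assms(2,3) that unfolding nonneg_def simple_reflection_def
    by (auto simp: lookup_minus lookup_uminus lookup_single when_def dest!: spec[of _ j])
  then have x: "x = Poly_Mapping.single i c"
    by (intro poly_mapping_eqI) (auto simp: c_def lookup_single when_def)
  have "c * c = 1"
    using root_norm[OF assms(1)] by (simp add: x form_linear form_simple_roots)
  moreover have "c \<ge> 0" using assms(2) by (simp add: c_def nonneg_def)
  ultimately have "c = 1"
    by (metis abs_of_nonneg abs_one mult_cancel_left1 power2_eq_1_iff power2_eq_square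
        zero_neq_one abs_minus_cancel)
  then show ?thesis by (simp add: x simple_root_def)
qed

text \<open>Roots have norm \<open>1\<close>; expand \<open>B (x + y) (x + y)\<close>.\<close>

lemma root_sum_form:
  assumes "root x" "root y" "root (x + y)"
  shows "B x y = - 1 / 2" "B x (x + y) = 1 / 2" "B y (x + y) = 1 / 2"
  using assms[THEN root_norm] by (simp_all add: form_linear form_sym[of y x])

section \<open>Root sequences\<close>

abbreviation rs :: "'i list \<Rightarrow> ('i \<Rightarrow>\<^sub>0 real) list" where
  "rs \<equiv> root_sequence m"

lemma length_rs [simp]: "length (rs u) = length u"
  by (simp add: root_sequence_def)

lemma rs_Nil [simp]: "rs [] = []"
  by (simp add: root_sequence_def)

text \<open>The sequence reads the word from its right end, so a letter put in front contributes the
  last root and leaves the others alone.\<close>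

lemma rs_Cons: "rs (i # u) = rs u @ [word_act m (rev u) (simple_root i)]"
proof -
  have "map (\<lambda>k. word_act m (take k (rev u @ [i])) (simple_root ((rev u @ [i]) ! k))) [0..<length u]
      = rs u"
    unfolding root_sequence_def by (rule map_cong) (auto simp: nth_append)
  then show ?thesis
    by (simp add: root_sequence_def nth_append)
qed

lemma rs_append: "rs (u @ v) = rs v @ map (word_act m (rev v)) (rs u)"
  by (induction u) (auto simp: rs_Cons)

text \<open>The last root, carried back by the remaining letters, is the simple root of the first
  letter.\<close>

lemma rs_inj: "length u = length v \<Longrightarrow> rs u = rs v \<Longrightarrow> u = v"
proof (induction u v rule: list_induct2)
  case (Cons i u j v)
  have "u = v" using Cons by (simp add: rs_Cons)
  moreover have "simple_root i = simple_root j"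
    using Cons.prems unfolding rs_Cons \<open>u = v\<close> by (metis append1_eq_conv word_act_rev')
  then have "i = j"
    unfolding simple_root_def by (metis lookup_single_eq lookup_single_not_eq zero_neq_one)
  ultimately show ?case by simp
qed simp

lemma reduced_ConsD:
  assumes "reduced (i # u)"
  shows "reduced u" "nonneg (word_act m (rev u) (simple_root i))"
proof -
  show "reduced u" using reduced_appendD(2)[of "[i]" u] assms by simp
  moreover have "reduced (rev u @ [i])" using assms reduced_rev[of "i # u"] by simp
  ultimately show "nonneg (word_act m (rev u) (simple_root i))"
    using reduced_rev[of u] by (simp add: ascent_iff reduced_def)
qed

text \<open>By \<open>sign_change\<close>, a further letter \<open>i\<close> on the left flips only
  the roots that \<open>u\<close> sends to plus or minus the simple root of \<open>i\<close>.
  Exactly one of these is positive, namely the appended root \<open>y\<close>.\<close>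

lemma set_rs:
  "reduced u \<Longrightarrow> set (rs u) = {x. root x \<and> nonneg x \<and> nonneg (- word_act m u x)}"
proof (induction u)
  case Nil
  then show ?case using root_not_both by auto
next
  case (Cons i u)
  note red = reduced_ConsD[OF Cons.prems]
  define y where "y = word_act m (rev u) (simple_root i)"
  have y: "root y" "nonneg y" "word_act m u y = simple_root i"
    using red by (auto simp: y_def root_act root_simple)
  have "x \<in> set (rs u) \<or> x = y \<longleftrightarrow> nonneg (- simple_reflection m i (word_act m u x))"
    if x: "root x" "nonneg x" for x
  proof
    assume "x \<in> set (rs u) \<or> x = y"
    then show "nonneg (- simple_reflection m i (word_act m u x))"
    proof
      assume "x \<in> set (rs u)"
      then have neg: "nonneg (- word_act m u x)" using Cons.IH[OF red(1)] by auto
      show ?thesis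
      proof (rule ccontr)
        assume "\<not> nonneg (- simple_reflection m i (word_act m u x))"
        then have "nonneg (simple_reflection m i (word_act m u x))"
          using root_sign[OF root_act[OF x(1), of "i # u"]] by simp
        then have "- word_act m u x = simple_root i"
          using sign_change[OF root_uminus[OF root_act[OF x(1), of u]] neg, of i]
            word_act_minus[of "[i]" "word_act m u x"] by simp
        then have "word_act m u (- x) = word_act m u y" using y(3) by (simp add: word_act_minus)
        then have "- x = y" by (metis word_act_rev)
        then show False using root_not_both[OF x] y(2) by simp
      qed
    next
      assume "x = y"
      then show ?thesis by (simp add: y(3) reflection_simple nonneg_simple)
    qed
  next
    assume neg: "nonneg (- simple_reflection m i (word_act m u x))"
    show "x \<in> set (rs u) \<or> x = y"
    proof (cases "nonneg (- word_act m u x)")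
      case True
      then show ?thesis using Cons.IH[OF red(1)] x by auto
    next
      case False
      then have "nonneg (word_act m u x)" using root_sign[OF root_act[OF x(1), of u]] by simp
      then have "word_act m u x = simple_root i"
        using sign_change[OF root_act[OF x(1)] _ neg] by simp
      then show ?thesis by (metis y_def word_act_rev)
    qed
  qed
  moreover have "set (rs (i # u)) = insert y (set (rs u))" by (simp add: rs_Cons y_def)
  moreover have "root x \<and> nonneg x" if "x \<in> set (rs u) \<or> x = y" for x
    using that Cons.IH[OF red(1)] y by auto
  ultimately show ?case by auto
qed

lemma rs_root:
  assumes "reduced u" "x \<in> set (rs u)"
  shows "root x" "nonneg x"
  using set_rs[OF assms(1)] assms(2) by auto

lemma distinct_rs: "reduced u \<Longrightarrow> distinct (rs u)"
proof (induction u)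
  case (Cons i u)
  note red = reduced_ConsD[OF Cons.prems]
  have "\<not> nonneg (- simple_root i)"
    using root_not_both[OF root_simple nonneg_simple] .
  then show ?case using Cons.IH[OF red(1)] set_rs[OF red(1)] by (simp add: rs_Cons)
qed simp

lemma set_rs_cong: "reduced u \<Longrightarrow> reduced v \<Longrightarrow> u \<approx> v \<Longrightarrow> set (rs u) = set (rs v)"
  by (simp add: set_rs word_act_eq_if_cong[of u v])

text \<open>The first roots of a sequence form the sequence of a suffix of the word, so
  \<open>set P\<close> is again an inversion set.\<close>

lemma rs_prefix:
  assumes "reduced u" "rs u = P @ Q"
  obtains v where "set P = {x. root x \<and> nonneg x \<and> nonneg (- word_act m v x)}"
proof -
  define u' v where "u' = take (length Q) u" and "v = drop (length Q) u"
  have u: "u = u' @ v" by (simp add: u'_def v_def)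
  have "length u = length P + length Q" using assms(2) length_rs by (metis length_append)
  then have "length (rs v) = length P" by (simp add: v_def)
  then have "P = rs v"
    using assms(2) unfolding u rs_append by (metis append_eq_append_conv)
  then show ?thesis
    using that[of v] set_rs[of v] reduced_appendD(2)[of u' v] assms(1) u by simp
qed

text \<open>\<open>P\<close> consists of the positive roots that a linear map makes negative, and
  both signs survive addition.\<close>

lemma prefix_closed:
  assumes "reduced u" "rs u = P @ Q" "x \<in> set P" "y \<in> set P" "root (x + y)"
  shows "x + y \<in> set P"
proof -
  obtain v where P: "set P = {x. root x \<and> nonneg x \<and> nonneg (- word_act m v x)}"
    using rs_prefix assms(1,2) by metis
  then show ?thesis
    using assms(3-5) nonneg_add[of x y] nonneg_add[of "- word_act m v x" "- word_act m v y"]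
    by (auto simp: word_act_add add.commute)
qed

text \<open>Positive roots outside \<open>P\<close> stay positive under the map that defines
  \<open>P\<close>, and then so does their sum.\<close>

lemma prefix_coclosed:
  assumes "reduced u" "rs u = P @ Q" "x + y \<in> set P" "root x" "nonneg x" "root y" "nonneg y"
  shows "x \<in> set P \<or> y \<in> set P"
proof (rule ccontr)
  obtain v where P: "set P = {x. root x \<and> nonneg x \<and> nonneg (- word_act m v x)}"
    using rs_prefix assms(1,2) by metis
  assume "\<not> (x \<in> set P \<or> y \<in> set P)"
  then have "nonneg (word_act m v x)" "nonneg (word_act m v y)"
    using P assms(4-7) root_sign[OF root_act, of _ v] by auto
  then have "nonneg (word_act m v (x + y))" by (simp add: word_act_add nonneg_add)
  then show False using assms(3) root_not_both[OF root_act, of "x + y" v] unfolding P by auto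
qed

text \<open>Closedness puts \<open>x + y\<close> into the segment ending with \<open>y\<close>;
  coclosedness keeps it out of the segment preceding \<open>x\<close>, where neither summand
  lies.\<close>

lemma before_sum:
  assumes "reduced u" "before (rs u) x y" "root (x + y)"
  shows "before (rs u) x (x + y)" "before (rs u) (x + y) y"
proof -
  note d = distinct_rs[OF assms(1)]
  note xy = rs_root[OF assms(1) before_set(1)[OF assms(2)]] rs_root[OF assms(1) before_set(2)[OF assms(2)]]
  have ne: "x + y \<noteq> x" "x + y \<noteq> y" using xy root_nonzero by auto
  obtain P M Q where L: "rs u = P @ x # M @ y # Q" using before_split[OF assms(2)] .
  have "x + y \<in> set (P @ x # M @ [y])"
    by (rule prefix_closed[OF assms(1) _ _ _ assms(3), of _ Q]) (auto simp: L)
  moreover have "x + y \<notin> set P"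
    using prefix_coclosed[OF assms(1), of P "x # M @ y # Q" x y] L d xy by auto
  ultimately have "x + y \<in> set M" using ne by auto
  then show "before (rs u) x (x + y)" "before (rs u) (x + y) y"
    by (auto simp: L before_append)
qed

text \<open>Apply coclosedness to \<open>p = (p - q) + q\<close> and the segment ending with
  \<open>p\<close>: it lacks \<open>q\<close>, so it contains \<open>p - q\<close>.\<close>

lemma before_difference:
  assumes "reduced u" "before (rs u) p q" "root (p - q)" "nonneg (p - q)"
  shows "before (rs u) (p - q) q"
proof -
  note d = distinct_rs[OF assms(1)]
  note q = rs_root[OF assms(1) before_set(2)[OF assms(2)]]
  obtain P M Q where L: "rs u = P @ p # M @ q # Q" using before_split[OF assms(2)] .
  have "q \<in> set (P @ [p]) \<or> p - q \<in> set (P @ [p])"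
    by (rule prefix_coclosed[OF assms(1), of _ "M @ q # Q"]) (use assms q L in auto)
  then have "p - q \<in> set (P @ [p])" using d L by auto
  then show ?thesis by (auto simp: L before_append)
qed

section \<open>Braid and commutation moves\<close>

definition braid_step :: "('i list \<times> 'i list) set" where
  "braid_step = {(x @ [i, j, i] @ y, x @ [j, i, j] @ y) | x y i j. m i j = 3}"

abbreviation commuting (infix "\<sim>" 50) where
  "u \<sim> v \<equiv> (u, v) \<in> (commutation_step m)\<^sup>*"

lemma commutation_stepI: "m i j = 2 \<Longrightarrow> (x @ [i, j] @ y, x @ [j, i] @ y) \<in> commutation_step m"
  unfolding commutation_step_def by blast

lemma braid_stepI: "m i j = 3 \<Longrightarrow> (x @ [i, j, i] @ y, x @ [j, i, j] @ y) \<in> braid_step"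
  unfolding braid_step_def by blast

lemma sym_commuting: "sym ((commutation_step m)\<^sup>*)"
proof (intro sym_rtrancl symI)
  fix u v assume "(u, v) \<in> commutation_step m"
  then obtain x y i j where "u = x @ [i, j] @ y" "v = x @ [j, i] @ y" "m i j = 2"
    by (auto simp: commutation_step_def)
  then show "(v, u) \<in> commutation_step m"
    using commutation_stepI[of j i x y] m_sym[of i j] by simp
qed

text \<open>The letters left of the swap see congruent words on their right, so their roots are
  unchanged; only the roots of the two letters trade places.\<close>

lemma commutation_step_rs:
  assumes "(u, v) \<in> commutation_step m"
  obtains A a b C where "rs u = A @ [a, b] @ C" "rs v = A @ [b, a] @ C" "B a b = 0"
    "u \<approx> v" "length u = length v"
proof -
  obtain x y i j where *: "u = x @ [i, j] @ y" "v = x @ [j, i] @ y" "m i j = 2"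
    using assms by (auto simp: commutation_step_def)
  have ne: "i \<noteq> j" using *(3) by auto
  have c: "[i, j] \<approx> [j, i]" by (rule cong_commute[OF *(3)])
  have "rev ([i, j] @ y) \<approx> rev ([j, i] @ y)" by (rule cong_rev[OF cong_appendR[OF c]])
  then have act: "word_act m (rev ([i, j] @ y)) = word_act m (rev ([j, i] @ y))"
    by (rule word_act_eq_if_cong)
  define C where "C = map (word_act m (rev ([j, i] @ y))) (rs x)"
  define a b where "a = word_act m (rev y) (simple_root j)" and "b = word_act m (rev y) (simple_root i)"
  have "rs u = rs ([i, j] @ y) @ map (word_act m (rev ([i, j] @ y))) (rs x)"
    "rs v = rs ([j, i] @ y) @ C"
    unfolding *(1,2) C_def by (rule rs_append)+
  then have "rs u = rs y @ [a, b] @ C" "rs v = rs y @ [b, a] @ C"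
    unfolding act C_def[symmetric] using *(3) ne m_sym[of i j]
    by (simp_all add: rs_Cons a_def b_def reflection_simple)
  moreover have "B a b = 0"
    using *(3) ne m_sym[of i j] by (simp add: a_def b_def word_act_isometry form_simple_roots)
  moreover have "u \<approx> v" unfolding * by (rule cong_appendL[OF cong_appendR[OF c]])
  ultimately show ?thesis using that * by simp
qed

lemma braid_step_rs:
  assumes "(u, v) \<in> braid_step"
  obtains A a b C where "rs u = A @ [a, a + b, b] @ C" "rs v = A @ [b, a + b, a] @ C"
    "u \<approx> v" "length u = length v"
proof -
  obtain x y i j where *: "u = x @ [i, j, i] @ y" "v = x @ [j, i, j] @ y" "m i j = 3"
    using assms by (auto simp: braid_step_def)
  have ne: "i \<noteq> j" using *(3) by auto
  have c: "[i, j, i] \<approx> [j, i, j]" by (rule cong_braid[OF *(3)])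
  have "rev ([i, j, i] @ y) \<approx> rev ([j, i, j] @ y)" by (rule cong_rev[OF cong_appendR[OF c]])
  then have act: "word_act m (rev ([i, j, i] @ y)) = word_act m (rev ([j, i, j] @ y))"
    by (rule word_act_eq_if_cong)
  define C where "C = map (word_act m (rev ([j, i, j] @ y))) (rs x)"
  define a b where "a = word_act m (rev y) (simple_root i)" and "b = word_act m (rev y) (simple_root j)"
  have "rs u = rs ([i, j, i] @ y) @ map (word_act m (rev ([i, j, i] @ y))) (rs x)"
    "rs v = rs ([j, i, j] @ y) @ C"
    unfolding *(1,2) C_def by (rule rs_append)+
  then have "rs u = rs y @ [a, a + b, b] @ C" "rs v = rs y @ [b, a + b, a] @ C"
    unfolding act C_def[symmetric] using *(3) ne m_sym[of i j]
    by (simp_all add: rs_Cons a_def b_def reflection_simple reflection_add word_act_add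
        word_act_minus add.commute)
  moreover have "u \<approx> v" unfolding * by (rule cong_appendL[OF cong_appendR[OF c]])
  ultimately show ?thesis using that * by simp
qed

lemma commuting_cong:
  assumes "u \<sim> v"
  shows "u \<approx> v \<and> length u = length v"
  using assms
proof (induction rule: rtrancl_induct)
  case (step y z)
  then show ?case using commutation_step_rs coxeter_cong.trans by metis
qed (simp add: coxeter_cong.refl)

text \<open>Neighbouring roots come from neighbouring letters, which differ by reducedness. Matrix
  entry \<open>2\<close> gives orthogonal roots and a swap; entry \<open>3\<close> gives
  \<open>y = x + b\<close> with \<open>b\<close> a root.\<close>

lemma adjacent_roots:
  assumes "reduced u" "rs u = A @ [x, y] @ C"
  shows "B x y = 0 \<and> (\<exists>v. (u, v) \<in> commutation_step m \<and> rs v = A @ [y, x] @ C)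
    \<or> B x y = 1 / 2 \<and> root (y - x)"
proof -
  \<comment> \<open>The sequence runs against the word, so the roots in \<open>C\<close> belong to
    the first \<open>length C\<close> letters.\<close>
  define c d where "c = take (length C) u" and "d = drop (length C + 2) u"
  have lu: "length u = length A + 2 + length C"
    using arg_cong[OF assms(2), of length] by simp
  have u: "u = c @ [u ! length C, u ! (length C + 1)] @ d"
    using lu by (simp add: c_def d_def id_take_nth_drop[symmetric] Cons_nth_drop_Suc)
  then obtain i j where u: "u = c @ [j, i] @ d" by blast
  have ld: "length (rs d) = length A" using lu by (simp add: d_def)
  define a b where "a = word_act m (rev d) (simple_root i)" and "b = word_act m (rev d) (simple_root j)"
  have "rs u = rs d @ [a, word_act m (rev d) (simple_reflection m i (simple_root j))]
      @ map (word_act m (rev ([j, i] @ d))) (rs c)"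
    unfolding u rs_append[of c] by (simp add: rs_Cons a_def)
  then have xy: "x = a" "y = word_act m (rev d) (simple_reflection m i (simple_root j))" "A = rs d"
    using assms(2) ld by (auto simp: append_eq_append_conv)
  have "i \<noteq> j"
  proof
    assume "i = j"
    then have "reduced [i, i]"
      using assms(1) unfolding u by (metis reduced_appendD)
    then show False using cong_double[of i] unfolding reduced_iff by fastforce
  qed
  then consider "m i j = 2" | "m i j = 3" using m_cases by blast
  then show ?thesis
  proof cases
    case 1
    then have y: "y = b" and xy0: "B x y = 0"
      using \<open>i \<noteq> j\<close> by (auto simp: xy reflection_simple b_def a_def word_act_isometry form_simple_roots)
    define v where "v = c @ [i, j] @ d"
    have uv: "(u, v) \<in> commutation_step m"
      unfolding u v_def using 1 m_sym[of i j] by (intro commutation_stepI) simp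
    have "rs v = rs d @ [b, word_act m (rev d) (simple_reflection m j (simple_root i))]
      @ map (word_act m (rev ([i, j] @ d))) (rs c)"
      unfolding v_def rs_append[of c] by (simp add: rs_Cons b_def)
    moreover have "word_act m (rev ([i, j] @ d)) = word_act m (rev ([j, i] @ d))"
      by (rule word_act_eq_if_cong[OF cong_rev[OF cong_appendR[OF cong_commute[OF 1]]]])
    moreover have "C = map (word_act m (rev ([j, i] @ d))) (rs c)"
      using assms(2) ld unfolding u rs_append[of c] by (auto simp: rs_Cons append_eq_append_conv)
    moreover have "word_act m (rev d) (simple_reflection m j (simple_root i)) = x"
      using 1 \<open>i \<noteq> j\<close> m_sym[of i j] by (simp add: xy a_def reflection_simple)
    ultimately have "rs v = A @ [y, x] @ C" by (simp add: xy(3) y)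
    then show ?thesis using xy0 uv by blast
  next
    case 2
    have y: "y = x + b"
      using 2 \<open>i \<noteq> j\<close> by (simp add: xy a_def b_def reflection_simple word_act_add add.commute)
    have "root b" by (simp add: b_def root_act root_simple)
    moreover have "B x y = 1 / 2"
      using 2 \<open>i \<noteq> j\<close> by (simp add: y xy a_def b_def form_linear word_act_isometry form_simple_roots)
    ultimately show ?thesis using y by simp
  qed
qed

section \<open>Matsumoto's theorem\<close>

lemma step_append:
  assumes "(u, v) \<in> (commutation_step m \<union> braid_step)\<^sup>*"
  shows "(u @ y, v @ y) \<in> (commutation_step m \<union> braid_step)\<^sup>*"
  using assms
proof (induction rule: rtrancl_induct)
  case (step v v')
  have "(v @ y, v' @ y) \<in> commutation_step m \<union> braid_step"
    using step.hyps(2) unfolding commutation_step_def braid_step_def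
    by (elim UnE CollectE exE conjE) (use commutation_stepI braid_stepI in fastforce)+
  then show ?case using step.IH by (rule rtrancl_into_rtrancl[rotated])
qed simp

text \<open>By \<open>ascent_iff\<close> the letter \<open>i\<close> shortens \<open>u\<close>; a
  reduced word of the shortened element with \<open>i\<close> put back at its end represents
  \<open>u\<close> again. This plays the part of the exchange condition below.\<close>

lemma obtain_descent:
  assumes "reduced u" "nonneg (- word_act m u (simple_root i))"
  obtains x where "reduced x" "x @ [i] \<approx> u" "length u = Suc (length x)"
    "\<And>y. word_act m x y = word_act m u (simple_reflection m i y)"
proof -
  have "\<not> len u < len (u @ [i])"
    using assms(2) ascent_iff root_not_both[OF root_act[OF root_simple]] by blast
  then have l: "len u = len (u @ [i]) + 1" using len_snoc_cases[of u i] by simp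
  obtain x where x: "u @ [i] \<approx> x" "reduced x" "length x = len (u @ [i])" by (rule obtain_reduced)
  have c: "x @ [i] \<approx> u" by (rule coxeter_cong.sym[OF cong_snoc_move[OF x(1)]])
  have "word_act m x y = word_act m u (simple_reflection m i y)" for y
    using word_act_eq_if_cong[OF x(1)] by (metis word_act_append word_act_Cons word_act_Nil id_apply)
  moreover have "length u = Suc (length x)" using x l assms(1) by (simp add: reduced_def)
  ultimately show ?thesis using that x(2) c by blast
qed

text \<open>Induct on the length and compare the last letters. Equal ones cancel. Different ones are
  both right descents, so the longest element of the dihedral subgroup they generate splits off on
  the right; one move between its two reduced words joins two applications of the induction
  hypothesis.\<close>

lemma matsumoto:
  "reduced u \<Longrightarrow> reduced v \<Longrightarrow> u \<approx> v \<Longrightarrow> (u, v) \<in> (commutation_step m \<union> braid_step)\<^sup>*"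
proof (induction "length u" arbitrary: u v rule: less_induct)
  case less
  let ?R = "(commutation_step m \<union> braid_step)\<^sup>*"
  have lv: "length v = length u" using reduced_length less.prems by metis
  show ?case
  proof (cases u rule: rev_cases)
    case Nil
    then show ?thesis using lv by simp
  next
    case (snoc u' i)
    then obtain v' j where v: "v = v' @ [j]" using lv by (cases v rule: rev_cases) auto
    have red: "reduced u'" "reduced v'"
      using less.prems(1,2) reduced_appendD(1) unfolding snoc v by blast+
    have IH: "(x @ y, x' @ y) \<in> ?R"
      if "length x < length u" "reduced x" "reduced x'" "x \<approx> x'" for x x' y
      using step_append[OF less.hyps[OF that]] .
    show ?thesis
    proof (cases "i = j")
      case True
      have "u' \<approx> v'" using less.prems(3) cong_snoc_cancel unfolding snoc v True by blast
      then show ?thesis using IH[of u' v' "[j]"] red by (simp add: snoc v True)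
    next
      case False
      have cv: "v' @ [j] \<approx> u" using less.prems(3) v coxeter_cong.sym by metis
      have neg: "nonneg (- word_act m (x @ [k]) (simple_root k))" if "reduced (x @ [k])" for x k
        using that reduced_appendD(1)[OF that] ascent_iff[of x k]
        by (simp add: reduced_def reflection_simple word_act_minus)
      have negj: "nonneg (- word_act m u (simple_root j))"
        using neg[of v' j] less.prems(2) word_act_eq_if_cong[OF less.prems(3)] by (simp add: v)
      have acti: "word_act m u' x = word_act m u (simple_reflection m i x)" for x
        by (simp add: snoc)
      have cancel: "x @ [k] \<approx> y @ [k] \<Longrightarrow> x \<approx> y" for x y k by (rule cong_snoc_cancel)
      have lu': "length u = Suc (length u')" "length v' = length u'" using snoc v lv by auto
      from m_cases[OF False] show ?thesis
      proof
        assume m2: "m i j = 2"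
        have "nonneg (- word_act m u' (simple_root j))"
          using negj m2 False by (simp add: acti reflection_simple)
        then obtain x where x: "reduced x" "x @ [j] \<approx> u'" "length u' = Suc (length x)"
          using obtain_descent red(1) by metis
        have c: "x @ [j, i] \<approx> u" using cong_appendR[OF x(2), of "[i]"] by (simp add: snoc)
        have c2: "x @ [i, j] \<approx> u"
          using coxeter_cong.trans[OF cong_appendL[OF cong_commute[OF m2]] c] .
        have c3: "x @ [i] \<approx> v'"
          using cancel[of "x @ [i]" j v'] coxeter_cong.trans[OF c2 coxeter_cong.sym[OF cv]] by simp
        have r1: "reduced (x @ [j])"
          using reduced_cong[OF red(1) coxeter_cong.sym[OF x(2)]] x(3) by simp
        have r2: "reduced (x @ [i])"
          using reduced_cong[OF red(2) coxeter_cong.sym[OF c3]] x(3) lu' by simp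
        have "(u, x @ [j, i]) \<in> ?R"
          using IH[of u' "x @ [j]" "[i]"] red(1) r1 coxeter_cong.sym[OF x(2)] lu' by (simp add: snoc)
        also have "(x @ [j, i], x @ [i, j]) \<in> ?R"
          using commutation_stepI[of j i x "[]"] m2 m_sym[of i j] by auto
        also have "(x @ [i, j], v) \<in> ?R"
          using IH[of "x @ [i]" v' "[j]"] red(2) r2 c3 lu' x(3) by (simp add: v)
        finally show ?thesis .
      next
        assume m3: "m i j = 3"
        \<comment> \<open>The image of the simple root of \<open>j\<close> under \<open>u'\<close>
          is the sum of the images of both simple roots under \<open>u\<close>, which are both
          negative.\<close>
        have "nonneg (- word_act m u (simple_root j) + - word_act m u (simple_root i))"
          using neg[of u' i] less.prems(1) negj by (intro nonneg_add) (simp_all add: snoc)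
        then have "nonneg (- word_act m u' (simple_root j))"
          using m3 False by (simp add: acti reflection_simple word_act_add)
        then obtain x where x: "reduced x" "x @ [j] \<approx> u'" "length u' = Suc (length x)"
           "\<And>y. word_act m x y = word_act m u' (simple_reflection m j y)"
          using obtain_descent[OF red(1)] by metis
        \<comment> \<open>The reflections in \<open>j\<close> and then \<open>i\<close> carry the
          simple root of \<open>i\<close> to that of \<open>j\<close>, which provides the second
          descent.\<close>
        have "word_act m x (simple_root i) = word_act m u (simple_root j)"
          using m3 False m_sym[of i j] unfolding x(4) acti
          by (simp add: reflection_simple reflection_add)
        then have "nonneg (- word_act m x (simple_root i))" using negj by simp
        then obtain y where y: "reduced y" "y @ [i] \<approx> x" "length x = Suc (length y)"
          using obtain_descent x(1) by metis
        have c0: "y @ [i, j] \<approx> u'"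
          using coxeter_cong.trans[OF cong_appendR[OF y(2), of "[j]"]] x(2) by simp
        have c: "y @ [i, j, i] \<approx> u" using cong_appendR[OF c0, of "[i]"] by (simp add: snoc)
        have c2: "y @ [j, i, j] \<approx> u"
          using coxeter_cong.trans[OF cong_appendL[OF coxeter_cong.sym[OF cong_braid[OF m3]]] c] .
        have c3: "y @ [j, i] \<approx> v'"
          using cancel[of "y @ [j, i]" j v'] coxeter_cong.trans[OF c2 coxeter_cong.sym[OF cv]] by simp
        have r1: "reduced (y @ [i, j])"
          using reduced_cong[OF red(1) coxeter_cong.sym[OF c0]] x(3) y(3) by simp
        have r2: "reduced (y @ [j, i])"
          using reduced_cong[OF red(2) coxeter_cong.sym[OF c3]] x(3) y(3) lu' by simp
        have "(u, y @ [i, j, i]) \<in> ?R"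
          using IH[of u' "y @ [i, j]" "[i]"] red(1) r1 coxeter_cong.sym[OF c0] lu' by (simp add: snoc)
        also have "(y @ [i, j, i], y @ [j, i, j]) \<in> ?R"
          using braid_stepI[of i j y "[]"] m3 by auto
        also have "(y @ [j, i, j], v) \<in> ?R"
          using IH[of "y @ [j, i]" v' "[j]"] red(2) r2 c3 lu' x(3) y(3) by (simp add: v)
        finally show ?thesis .
      qed
    qed
  qed
qed

lemma commuting_before:
  assumes "u \<sim> v" "before (rs u) a b" "B a b \<noteq> 0"
  shows "before (rs v) a b"
  using assms(1)
proof (induction rule: rtrancl_induct)
  case (step y z)
  from step.hyps(2) obtain A p q C
    where "rs y = A @ [p, q] @ C" "rs z = A @ [q, p] @ C" "B p q = 0"
    by (rule commutation_step_rs)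
  then show ?case using step.IH assms(3) by (auto simp: before_append)
qed (rule assms(2))

end

section \<open>Inversion triples\<close>

text \<open>The reduced word \<open>e\<close> stands for the group element; by \<open>set_rs\<close>
  its inversion set is \<open>set (rs e)\<close>.\<close>

locale reduced_word = simply_laced_matrix m for m :: "'i \<Rightarrow> 'i \<Rightarrow> nat" +
  fixes e :: "'i list"
  assumes reduced_e: "reduced e"
begin

definition exprs :: "'i list set" where
  "exprs = {u. reduced u \<and> e \<approx> u}"

definition consecutive :: "('i \<Rightarrow>\<^sub>0 real) set \<Rightarrow> 'i list \<Rightarrow> bool" where
  "consecutive T u \<longleftrightarrow> (\<exists>A x y z C. rs u = A @ [x, y, z] @ C \<and> T = {x, y, z})"

definition contractible :: "('i \<Rightarrow>\<^sub>0 real) set set" where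
  "contractible =
    {T. T \<subseteq> set (rs e) \<and> (\<exists>a b. T = {a, b, a + b}) \<and> (\<exists>u\<in>exprs. consecutive T u)}"

text \<open>The orientation of a triple is the order of its two outer roots. The condition
  \<open>a + b \<in> T\<close> singles these out without fixing names for them, as
  \<open>triple_pair\<close> shows.\<close>

definition disagree :: "'i list \<Rightarrow> 'i list \<Rightarrow> ('i \<Rightarrow>\<^sub>0 real) set set" where
  "disagree u v = {T \<in> contractible.
     \<exists>a\<in>T. \<exists>b\<in>T. a + b \<in> T \<and> before (rs u) a b \<and> before (rs v) b a}"

section \<open>Orientations of contractible triples\<close>

lemma e_exprs: "e \<in> exprs"
  by (simp add: exprs_def reduced_e coxeter_cong.refl)

lemma exprsD:
  assumes "u \<in> exprs"
  shows "reduced u" "distinct (rs u)" "set (rs u) = set (rs e)"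
  using assms distinct_rs set_rs_cong[of e u] reduced_e by (auto simp: exprs_def)

lemma exprs_cong: "u \<in> exprs \<Longrightarrow> v \<in> exprs \<Longrightarrow> u \<approx> v"
  unfolding exprs_def using coxeter_cong.sym coxeter_cong.trans by blast

lemma exprs_closed:
  assumes "u \<in> exprs" "u \<approx> v" "length v = length u"
  shows "v \<in> exprs"
  using assms reduced_cong coxeter_cong.trans unfolding exprs_def by blast

lemma exprs_commuting: "u \<in> exprs \<Longrightarrow> u \<sim> v \<Longrightarrow> v \<in> exprs"
  using commuting_cong[of u v] exprs_closed[of u v] by simp

lemma e_roots: "x \<in> set (rs e) \<Longrightarrow> root x \<and> nonneg x"
  using rs_root reduced_e by blast

lemma roots_sum_neq:
  assumes "x \<in> set (rs e)" "y \<in> set (rs e)"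
  shows "x + y \<noteq> 0" "x + y \<noteq> x" "x + y \<noteq> y"
proof -
  note xy = e_roots[OF assms(1)] e_roots[OF assms(2)]
  show "x + y \<noteq> 0"
  proof
    assume "x + y = 0"
    then have "y = - x" by (metis add.inverse_unique)
    then show False using xy root_not_both by blast
  qed
qed (use assms e_roots root_nonzero in auto)

lemma contractible_form:
  assumes "{a, b, a + b} \<in> contractible"
  shows "a \<in> set (rs e)" "b \<in> set (rs e)" "a + b \<in> set (rs e)" "root (a + b)" "a \<noteq> b"
    "B a b = - 1 / 2" "B a (a + b) = 1 / 2" "B b (a + b) = 1 / 2"
proof -
  show *: "a \<in> set (rs e)" "b \<in> set (rs e)" "a + b \<in> set (rs e)"
    using assms unfolding contractible_def by auto
  show "root (a + b)" using * e_roots by blast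
  show B: "B a b = - 1 / 2" "B a (a + b) = 1 / 2" "B b (a + b) = 1 / 2"
    using root_sum_form[of a b] * e_roots by blast+
  show "a \<noteq> b" using B(1) root_norm[of a] e_roots[OF *(1)] by auto
qed

text \<open>Inner products decide: only the two outer roots have product \<open>- 1 / 2\<close>; all
  other pairs give \<open>1 / 2\<close> or \<open>1\<close>.\<close>

lemma triple_pair:
  assumes "{a, b, a + b} \<in> contractible" "c \<in> {a, b, a + b}" "d \<in> {a, b, a + b}"
    "c + d \<in> {a, b, a + b}"
  shows "c = a \<and> d = b \<or> c = b \<and> d = a"
proof -
  note ab = contractible_form[OF assms(1)]
  have "{a, b, a + b} \<subseteq> set (rs e)" using ab(1-3) by simp
  then have cd: "c \<in> set (rs e)" "d \<in> set (rs e)" "c + d \<in> set (rs e)"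
    using assms(2-4) by (blast dest: subsetD)+
  then have "B c d = - 1 / 2" using root_sum_form(1)[of c d] e_roots by blast
  moreover have "B x x \<noteq> - 1 / 2" if "x \<in> set (rs e)" for x
    using root_norm e_roots[OF that] by simp
  moreover have "B (a + b) a = 1 / 2" "B (a + b) b = 1 / 2"
    using ab form_sym by auto
  ultimately show ?thesis using assms(2,3) ab by auto
qed

lemma contractible_cases:
  assumes "T \<in> contractible"
  obtains a b where "T = {a, b, a + b}"
  using assms unfolding contractible_def by blast

lemma contractible_total:
  assumes "{a, b, a + b} \<in> contractible" "u \<in> exprs"
  shows "before (rs u) a b \<longleftrightarrow> \<not> before (rs u) b a"
  using before_total before_asym exprsD[OF assms(2)] contractible_form[OF assms(1)] by metis

lemma disagree_iff:
  assumes "{a, b, a + b} \<in> contractible" "u \<in> exprs" "v \<in> exprs"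
  shows "{a, b, a + b} \<in> disagree u v \<longleftrightarrow> (before (rs u) a b \<longleftrightarrow> before (rs v) b a)"
proof
  assume "{a, b, a + b} \<in> disagree u v"
  then obtain c d where cd: "c \<in> {a, b, a + b}" "d \<in> {a, b, a + b}" "c + d \<in> {a, b, a + b}"
    "before (rs u) c d" "before (rs v) d c"
    unfolding disagree_def by blast
  then show "before (rs u) a b \<longleftrightarrow> before (rs v) b a"
    using triple_pair[OF assms(1) cd(1-3)] contractible_total[OF assms(1)] assms(2,3) by auto
next
  assume "before (rs u) a b \<longleftrightarrow> before (rs v) b a"
  then have "before (rs u) a b \<and> before (rs v) b a \<or> before (rs u) b a \<and> before (rs v) a b"
    using contractible_total[OF assms(1)] assms(2,3) by auto
  then show "{a, b, a + b} \<in> disagree u v"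
    unfolding disagree_def using assms(1) by (auto simp: add.commute)
qed

lemma disagree_contractible: "disagree u v \<subseteq> contractible"
  by (auto simp: disagree_def)

text \<open>A triple has just two orientations, so disagreements add modulo two. Thus
  \<open>disagree e\<close> codes the orientations in an expression as a subset of
  \<open>contractible\<close>, with \<open>e\<close> as the origin.\<close>

lemma disagree_symdiff:
  assumes "u \<in> exprs" "v \<in> exprs" "T \<in> contractible"
  shows "T \<in> disagree u v \<longleftrightarrow> (T \<in> disagree e u \<longleftrightarrow> T \<notin> disagree e v)"
proof -
  obtain a b where T: "T = {a, b, a + b}" using assms(3) by (rule contractible_cases)
  note c = assms(3)[unfolded T]
  show ?thesis
    unfolding T using disagree_iff[OF c] contractible_total[OF c] assms(1,2) e_exprs by metis
qed

lemma disagree_commuting: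
  assumes "u \<in> exprs" "v \<in> exprs" "u \<sim> u'"
  shows "disagree u v = disagree u' v"
proof -
  note u' = exprs_commuting[OF assms(1,3)]
  have "T \<in> disagree u v \<longleftrightarrow> T \<in> disagree u' v" if T: "T \<in> contractible" for T
  proof -
    obtain a b where ab: "T = {a, b, a + b}" using T by (rule contractible_cases)
    note c = T[unfolded ab]
    have "B a b \<noteq> 0" "B b a \<noteq> 0" using contractible_form(6)[OF c] form_sym[of b a] by auto
    then have "before (rs u) a b \<longleftrightarrow> before (rs u') a b"
      using commuting_before[OF assms(3)] contractible_total[OF c] assms(1) u' by blast
    then show ?thesis
      unfolding ab disagree_iff[OF c assms(1,2)] disagree_iff[OF c u' assms(2)] by simp
  qed
  then show ?thesis using disagree_contractible by blast
qed

text \<open>A braid move reverses only the triple it acts on, so by Matsumoto's theorem the other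
  triples have the same orientation in all root sequences.\<close>

lemma flip_contractible:
  assumes "u \<in> exprs" "v \<in> exprs" "before (rs u) a b" "before (rs v) b a" "root (a + b)"
  shows "{a, b, a + b} \<in> contractible"
proof (rule ccontr)
  assume nc: "{a, b, a + b} \<notin> contractible"
  have mem: "a \<in> set (rs e)" "b \<in> set (rs e)"
    using before_set[OF assms(3)] exprsD(3)[OF assms(1)] by auto
  have Bab: "B a b = - 1 / 2" using root_sum_form(1) e_roots mem assms(5) by blast
  have mems: "a + b \<in> set (rs e)"
    using before_set(2)[OF before_sum(1)[OF exprsD(1)[OF assms(1)] assms(3,5)]]
      exprsD(3)[OF assms(1)] by simp
  have "(u, v) \<in> (commutation_step m \<union> braid_step)\<^sup>*"
    using matsumoto exprsD(1) exprs_cong assms(1,2) by blast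
  then have "v \<in> exprs \<and> before (rs v) a b"
  proof (induction rule: rtrancl_induct)
    case (step y z)
    then have y: "y \<in> exprs" "before (rs y) a b" by auto
    from step.hyps(2) show ?case
    proof
      assume yz: "(y, z) \<in> commutation_step m"
      then have "y \<sim> z" by blast
      then show ?thesis using exprs_commuting commuting_before y Bab by force
    next
      assume "(y, z) \<in> braid_step"
      then obtain A p q C where *: "rs y = A @ [p, p + q, q] @ C" "rs z = A @ [q, p + q, p] @ C"
        "y \<approx> z" "length y = length z"
        by (rule braid_step_rs)
      have z: "z \<in> exprs" using exprs_closed[OF y(1) *(3)] *(4) by simp
      have "p \<in> set (rs e)" "q \<in> set (rs e)" "p + q \<in> set (rs e)"
        using *(1) unfolding exprsD(3)[OF y(1), symmetric] by auto
      then have "B p (p + q) = 1 / 2" "B q (p + q) = 1 / 2"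
        using root_sum_form[of p q] e_roots by blast+
      \<comment> \<open>The braid move reverses three pairs. Those containing the sum are excluded
        by their product \<open>1 / 2\<close>, and the outer pair would make the triple consecutive
        in \<open>y\<close>.\<close>
      then have "\<not> (a = p \<and> b = p + q)" "\<not> (a = p + q \<and> b = q)"
        using Bab form_sym[of q "p + q"] by auto
      moreover have "\<not> (a = p \<and> b = q)"
      proof
        assume pq: "a = p \<and> b = q"
        then have "consecutive {a, b, a + b} y"
          unfolding consecutive_def *(1) by blast
        then have "{a, b, a + b} \<in> contractible"
          unfolding contractible_def using y(1) mem mems by blast
        then show False using nc by simp
      qed
      ultimately have "before (rs z) a b"
        using y(2) unfolding *(1,2) by (auto simp: before_append)
      then show ?thesis using z by simp
    qed
  qed (use assms in simp)
  then show False using assms(4) before_asym[OF exprsD(2)] by blast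
qed

text \<open>By \<open>adjacent_roots\<close> one of \<open>x\<close>, \<open>y\<close> is the sum of
  the other and a positive root \<open>z\<close>. Sums lie between their summands, which forces the
  position of \<open>z\<close> in both sequences: the triple of the three roots is reversed, hence
  contractible by \<open>flip_contractible\<close>.\<close>

lemma adjacent_disagree:
  assumes "u \<in> exprs" "v \<in> exprs" "rs u = A @ [x, y] @ C" "before (rs v) y x" "B x y \<noteq> 0"
  shows "\<exists>T\<in>disagree u v. x \<in> T \<and> y \<in> T"
proof -
  note ru = exprsD(1)[OF assms(1)] and rv = exprsD(1)[OF assms(2)]
  have xy: "before (rs u) x y" unfolding assms(3) by (simp add: before_append)
  have r: "root (y - x)" using adjacent_roots[OF ru assms(3)] assms(5) by blast
  have mem: "x \<in> set (rs e)" "y \<in> set (rs e)"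
    using before_set[OF xy] exprsD(3)[OF assms(1)] by auto
  from root_sign[OF r] show ?thesis
  proof
    assume "nonneg (y - x)"
    define z where "z = y - x"
    have y: "y = x + z" by (simp add: z_def)
    have zx: "before (rs v) z x"
      using before_difference[OF rv assms(4)] r \<open>nonneg (y - x)\<close> by (simp add: z_def)
    have z: "z \<in> set (rs u)" using before_set(1)[OF zx] exprsD(3) assms(1,2) by simp
    have ry: "root (x + z)" using e_roots[OF mem(2)] y by simp
    have "x \<noteq> z" using before_neq[OF exprsD(2)[OF assms(2)] zx] by simp
    have "before (rs u) x z"
    proof (rule ccontr)
      assume "\<not> before (rs u) x z"
      then have "before (rs u) z x"
        using before_total[of x "rs u" z] z before_set(1)[OF xy] \<open>x \<noteq> z\<close> by simp
      then have "before (rs u) y x"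
        using before_sum(2)[OF ru, of z x] ry y by (simp add: add.commute)
      then show False using xy before_asym[OF exprsD(2)[OF assms(1)]] by blast
    qed
    then have "{x, z, x + z} \<in> disagree u v"
      using flip_contractible[OF assms(1,2) _ zx ry] zx unfolding disagree_def by auto
    then show ?thesis using y by auto
  next
    assume "nonneg (- (y - x))"
    \<comment> \<open>The mirror case: \<open>x\<close> is the sum, and \<open>u\<close> and
      \<open>v\<close> exchange their parts.\<close>
    define z where "z = x - y"
    have x: "x = y + z" by (simp add: z_def)
    have zy: "before (rs u) z y"
      using before_difference[OF ru xy] root_uminus[OF r] \<open>nonneg (- (y - x))\<close> by (simp add: z_def)
    have z: "z \<in> set (rs v)" using before_set(1)[OF zy] exprsD(3) assms(1,2) by simp
    have rx: "root (z + y)" using e_roots[OF mem(1)] x by (simp add: add.commute)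
    have "z \<noteq> y" using before_neq[OF exprsD(2)[OF assms(1)] zy] by simp
    have yz: "before (rs v) y z"
    proof (rule ccontr)
      assume "\<not> before (rs v) y z"
      then have "before (rs v) z y"
        using before_total[of y "rs v" z] z before_set(1)[OF assms(4)] \<open>z \<noteq> y\<close> by simp
      then have "before (rs v) x y"
        using before_sum(2)[OF rv, of z y] rx x by (simp add: add.commute)
      then show False using assms(4) before_asym[OF exprsD(2)[OF assms(2)]] by blast
    qed
    have "{z, y, z + y} \<in> disagree u v"
      using flip_contractible[OF assms(1,2) zy yz rx] zy yz unfolding disagree_def by auto
    then show ?thesis using x by (auto simp: add.commute)
  qed
qed

text \<open>Bubble sort within the commutation class: swapping an adjacent orthogonal pair that
  \<open>v\<close> lists in the opposite order removes an inversion relative to \<open>v\<close>, so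
  the process ends.\<close>

lemma straighten:
  assumes "u \<in> exprs" "v \<in> exprs"
  obtains u' where "u \<sim> u'"
    "\<And>A x y C. rs u' = A @ [x, y] @ C \<Longrightarrow> before (rs v) y x \<Longrightarrow> B x y \<noteq> 0"
proof -
  define I where "I u = {(x, y). before (rs u) x y \<and> before (rs v) y x}" for u
  have fin: "finite (I u)" for u
    by (rule finite_subset[of _ "set (rs u) \<times> set (rs u)"]) (auto simp: I_def dest: before_set)
  have "\<exists>u'. u \<sim> u' \<and> (\<forall>A x y C. rs u' = A @ [x, y] @ C \<longrightarrow> before (rs v) y x \<longrightarrow> B x y \<noteq> 0)"
    using assms(1)
  proof (induction "card (I u)" arbitrary: u rule: less_induct)
    case less
    show ?case
    proof (cases "\<exists>A x y C. rs u = A @ [x, y] @ C \<and> before (rs v) y x \<and> B x y = 0")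
      case True
      then obtain A x y C where *: "rs u = A @ [x, y] @ C" "before (rs v) y x" "B x y = 0" by blast
      then obtain z where z: "(u, z) \<in> commutation_step m" "rs z = A @ [y, x] @ C"
        using adjacent_roots[OF exprsD(1)[OF less.prems] *(1)] by auto
      have zx: "z \<in> exprs" using exprs_commuting[OF less.prems] z(1) by blast
      have d: "distinct (rs v)" using exprsD assms(2) by blast
      have "(x, y) \<in> I u" using * by (simp add: I_def before_append)
      moreover have "(x, y) \<notin> I z"
        using before_asym[OF exprsD(2)[OF zx], of y x] by (simp add: I_def z before_append)
      moreover have "I z \<subseteq> I u"
        using before_asym[OF d *(2)] by (auto simp: I_def *(1) z(2) before_append)
      ultimately have "card (I z) < card (I u)"
        by (intro psubset_card_mono fin) blast
      then obtain u' where "z \<sim> u'"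
        "\<forall>A x y C. rs u' = A @ [x, y] @ C \<longrightarrow> before (rs v) y x \<longrightarrow> B x y \<noteq> 0"
        using less.hyps zx by blast
      then show ?thesis using z(1) converse_rtrancl_into_rtrancl by metis
    qed blast
  qed
  then show ?thesis using that by blast
qed

text \<open>After straightening, any remaining inversion relative to \<open>v\<close> would yield an
  adjacent one; this pair is not orthogonal and so lies in a triple of disagreement. Hence the root
  sequences coincide.\<close>

lemma commuting_if_agree:
  assumes "u \<in> exprs" "v \<in> exprs" "disagree u v = {}"
  shows "u \<sim> v"
proof -
  obtain u' where u': "u \<sim> u'"
    "\<And>A x y C. rs u' = A @ [x, y] @ C \<Longrightarrow> before (rs v) y x \<Longrightarrow> B x y \<noteq> 0"
    using straighten[OF assms(1,2)] by blast
  have ex: "u' \<in> exprs" using exprs_commuting[OF assms(1) u'(1)] .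
  have dis: "disagree u' v = {}" using disagree_commuting[OF assms(1,2) u'(1)] assms(3) by simp
  note d = exprsD(2)[OF ex] exprsD(2)[OF assms(2)]
  have seteq: "set (rs u') = set (rs v)" using exprsD(3) ex assms(2) by simp
  have "rs u' = rs v"
  proof (rule list_eq_if_before[OF d seteq])
    fix a b assume ab: "before (rs u') a b"
    show "before (rs v) a b"
    proof (rule ccontr)
      assume "\<not> before (rs v) a b"
      then have ba: "before (rs v) b a"
        using before_total before_set[OF ab] before_neq[OF d(1) ab] seteq by metis
      obtain P M Q where "rs u' = P @ a # M @ b # Q" using ab by (rule before_split)
      then obtain P' p q Q' where "rs u' = P' @ [p, q] @ Q'" "before (rs v) q p"
        using adjacent_inversion[OF d(2,1) seteq _ ba] by blast
      then show False using adjacent_disagree[OF ex assms(2)] u'(2) dis by blast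
    qed
  qed
  moreover have "length u' = length v"
    using reduced_length exprsD(1) exprs_cong ex assms(2) by blast
  ultimately have "u' = v" by (intro rs_inj) auto
  then show ?thesis using u'(1) by simp
qed

text \<open>After straightening towards \<open>v\<close>, every adjacent inversion is a pair inside
  the one triple. Foreign roots between its members would produce an adjacent inversion that is
  not.\<close>

lemma consecutive_if_disagree_singleton:
  assumes "u \<in> exprs" "v \<in> exprs" "disagree u v = {{a, b, a + b}}" "before (rs u) a b"
  obtains u' A C where "u \<sim> u'" "rs u' = A @ [a, a + b, b] @ C"
proof -
  let ?c = "a + b"
  have c: "{a, b, ?c} \<in> contractible" using assms(3) disagree_contractible by blast
  note form = contractible_form[OF c]
  obtain u' where u': "u \<sim> u'"
    "\<And>A x y C. rs u' = A @ [x, y] @ C \<Longrightarrow> before (rs v) y x \<Longrightarrow> B x y \<noteq> 0"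
    using straighten[OF assms(1,2)] by blast
  have ex: "u' \<in> exprs" using exprs_commuting[OF assms(1) u'(1)] .
  have dis: "disagree u' v = {{a, b, ?c}}"
    using disagree_commuting[OF assms(1,2) u'(1)] assms(3) by simp
  note d = exprsD(2)[OF ex] exprsD(2)[OF assms(2)]
  have seteq: "set (rs u') = set (rs v)" using exprsD(3) ex assms(2) by simp
  have ab: "before (rs u') a b" using commuting_before[OF u'(1) assms(4)] form by simp
  have ba: "before (rs v) b a"
    using disagree_iff[OF c ex assms(2)] ab dis by simp
  have rba: "root (b + a)" using form(4) by (simp add: add.commute)
  \<comment> \<open>\<open>u'\<close> lists the triple as \<open>a, a + b, b\<close> and
    \<open>v\<close> as \<open>b, a + b, a\<close>, so both neighbouring pairs are inverted.\<close>
  note ord_u = before_sum[OF exprsD(1)[OF ex] ab form(4)]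
  note ord_v = before_sum[OF exprsD(1)[OF assms(2)] ba rba, unfolded add.commute[of b a]]
  obtain P M Q where L1: "rs u' = P @ a # M @ ?c # Q" using ord_u(1) by (rule before_split)
  have "b \<in> set Q"
    using ord_u(2) d(1) unfolding L1 by (auto simp: before_append dest: before_set)
  then obtain N R where "Q = N @ b # R" by (meson split_list)
  then have L: "rs u' = P @ a # M @ ?c # N @ b # R" using L1 by simp
  \<comment> \<open>The stretch from \<open>x\<close> to \<open>y\<close> contains an adjacent
    inversion made of members of the triple; as \<open>K\<close> has none, it is the pair
    \<open>x, y\<close> itself.\<close>
  have adj: "K = []"
    if dec: "rs u' = P @ x # K @ y # Q" and inv: "before (rs v) y x"
      and K: "set K \<inter> {a, b, ?c} = {}" for P Q K x y
  proof -
    obtain P' p q Q' where pq: "rs u' = P' @ [p, q] @ Q'" "before (rs v) q p"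
      "{p, q} \<subseteq> insert x (insert y (set K))"
      using adjacent_inversion[OF d(2,1) seteq dec inv] by blast
    then have "p \<in> {a, b, ?c}" "q \<in> {a, b, ?c}"
      using adjacent_disagree[OF ex assms(2) pq(1,2) u'(2)[OF pq(1,2)]] by (simp_all add: dis)
    then have "p \<in> {x, y}" "q \<in> {x, y}" using pq(3) K by auto
    then have "p = x" "q = y"
      using pq(2) inv before_asym[OF d(2)] before_neq[OF d(2)] by blast+
    then have "P' @ x # (y # Q') = P @ x # (K @ y # Q)" using pq(1) dec by simp
    then have "y # Q' = K @ y # Q"
      using d(1) unfolding dec by (subst (asm) append_Cons_eq_iff) (use pq(1) dec d(1) \<open>p = x\<close> in auto)
    then show ?thesis using d(1) unfolding dec by (cases K) auto
  qed
  have "M = []"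
    by (rule adj[of P a M ?c "N @ b # R"]) (use L d(1) ord_v in auto)
  moreover have "N = []"
    by (rule adj[of "P @ a # M" ?c N b R]) (use L d(1) ord_v in auto)
  ultimately show ?thesis using that u'(1) L by simp
qed

end

section \<open>The case of equality: every choice of orientations occurs\<close>

locale extremal_word = reduced_word m e
  for m :: "'i \<Rightarrow> 'i \<Rightarrow> nat" and e :: "'i list" +
  assumes card_classes: "card (exprs // (commutation_step m)\<^sup>*) = 2 ^ card contractible"
begin

lemma finite_contractible: "finite contractible"
  by (rule finite_subset[of _ "Pow (set (rs e))"]) (auto simp: contractible_def)

text \<open>A commutation class is determined by its value of \<open>disagree e\<close>, so there
  are at most as many classes as attained subsets of \<open>contractible\<close>. Equality with the
  size of the power set leaves no subset out.\<close>

lemma surjective: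
  assumes "S \<subseteq> contractible"
  obtains u where "u \<in> exprs" "disagree e u = S"
proof -
  define same_orientation where "same_orientation S = {v \<in> exprs. disagree e v = S}" for S
  have "(commutation_step m)\<^sup>* `` {u} = same_orientation (disagree e u)" if u: "u \<in> exprs" for u
  proof -
    have "v \<in> same_orientation (disagree e u)" if "u \<sim> v" for v
    proof -
      have "v \<in> exprs" using exprs_commuting[OF u that] .
      moreover have "disagree u v = disagree v v"
        using disagree_commuting[OF u _ that] calculation by simp
      moreover have "disagree v v = {}"
        using before_asym[OF exprsD(2)] calculation(1) unfolding disagree_def by blast
      ultimately show ?thesis
        using disagree_symdiff[OF u] disagree_contractible unfolding same_orientation_def by blast
    qed
    moreover have "u \<sim> v" if "v \<in> same_orientation (disagree e u)" for v
    proof -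
      have v: "v \<in> exprs" "disagree e v = disagree e u" using that by (auto simp: same_orientation_def)
      then have "disagree u v = {}"
        using disagree_symdiff[OF u v(1)] disagree_contractible by blast
      then show ?thesis using commuting_if_agree[OF u v(1)] by simp
    qed
    ultimately show ?thesis by auto
  qed
  then have "exprs // (commutation_step m)\<^sup>* = same_orientation ` disagree e ` exprs"
    unfolding quotient_def by auto
  moreover have sub: "disagree e ` exprs \<subseteq> Pow contractible"
    using disagree_contractible by blast
  then have fin: "finite (disagree e ` exprs)"
    using finite_contractible by (simp add: finite_subset)
  ultimately have "2 ^ card contractible \<le> card (disagree e ` exprs)"
    using card_image_le[OF fin, of same_orientation] card_classes by simp
  then have "disagree e ` exprs = Pow contractible"
    using card_seteq[OF _ sub] finite_contractible by (simp add: card_Pow)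
  then show ?thesis using assms that by (metis PowI imageE)
qed

lemma obtain_consecutive:
  assumes "u \<in> exprs" "{a, b, a + b} \<in> contractible" "before (rs u) a b"
  obtains u' A C where "u \<sim> u'" "rs u' = A @ [a, a + b, b] @ C"
proof -
  let ?T = "{a, b, a + b}"
  \<comment> \<open>\<open>S\<close> is \<open>disagree e u\<close> with the membership of
    \<open>?T\<close> toggled.\<close>
  define S where "S = {T \<in> contractible. (T \<in> disagree e u) \<noteq> (T = ?T)}"
  obtain v where v: "v \<in> exprs" "disagree e v = S"
    using surjective[of S] by (auto simp: S_def)
  have "T \<in> disagree u v \<longleftrightarrow> T = ?T" if "T \<in> contractible" for T
    unfolding disagree_symdiff[OF assms(1) v(1) that] v(2) S_def using that by auto
  then have "disagree u v = {?T}"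
    using disagree_contractible assms(2) by blast
  then show ?thesis
    using consecutive_if_disagree_singleton[OF assms(1) v(1) _ assms(3)] that by blast
qed

lemma orient:
  assumes "{a, b, a + b} \<in> contractible" "{c, d, c + d} \<in> contractible"
    "{a, b, a + b} \<noteq> {c, d, c + d}"
  obtains u where "u \<in> exprs" "before (rs u) a b" "before (rs u) c d"
proof -
  \<comment> \<open>Reverse those of the two triples that \<open>e\<close> orients the wrong way; as
    the triples differ, the two choices are independent.\<close>
  define S where "S = {T \<in> contractible. T = {a, b, a + b} \<and> before (rs e) b a
    \<or> T = {c, d, c + d} \<and> before (rs e) d c}"
  obtain u where u: "u \<in> exprs" "disagree e u = S"
    using surjective[of S] by (auto simp: S_def)
  have "{a, b, a + b} \<in> S \<longleftrightarrow> before (rs e) b a" "{c, d, c + d} \<in> S \<longleftrightarrow> before (rs e) d c"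
    using assms unfolding S_def by blast+
  then have "before (rs u) a b" "before (rs u) c d"
    using disagree_iff[OF assms(1) e_exprs u(1)] disagree_iff[OF assms(2) e_exprs u(1)]
      contractible_total[OF assms(1)] contractible_total[OF assms(2)] e_exprs u by auto
  then show ?thesis using that u(1) by blast
qed

section \<open>Two contractible triples with a common root\<close>

lemma before_next:
  assumes "distinct L" "L = A @ [t, x] @ C" "before L t y" "y \<noteq> x"
  shows "before L x y"
  using assms by (auto simp: before_append dest: before_set)

lemma reversed_orthogonal:
  assumes "u1 \<in> exprs" "u1 \<sim> u2" "before (rs u1) x y" "before (rs u2) y x"
  shows "B x y = 0"
  using commuting_before[OF assms(2,3)] before_asym[OF exprsD(2)] exprs_commuting[OF assms(1,2)]
    assms(4) by blast

text \<open>In both sequences \<open>t\<close> precedes \<open>x\<close> and \<open>y\<close>, since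
  neither is orthogonal to it. The immediate successor comes first, so \<open>x\<close> and
  \<open>y\<close> appear in opposite orders.\<close>

lemma successors_orthogonal:
  assumes "u1 \<in> exprs" "u1 \<sim> u2" "rs u1 = A @ [t, x] @ C" "rs u2 = A' @ [t, y] @ C'" "x \<noteq> y"
    "B t x \<noteq> 0" "B t y \<noteq> 0"
  shows "B x y = 0"
proof (rule reversed_orthogonal[OF assms(1,2)])
  note u2 = exprs_commuting[OF assms(1,2)]
  have u21: "u2 \<sim> u1" using sym_commuting assms(2) by (meson symD)
  have 1: "before (rs u1) t x" "before (rs u2) t y"
    unfolding assms(3,4) by (simp_all add: before_append)
  show "before (rs u1) x y"
    using before_next[OF exprsD(2)[OF assms(1)] assms(3)] commuting_before[OF u21 1(2)] assms by auto
  show "before (rs u2) y x"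
    using before_next[OF exprsD(2)[OF u2] assms(4)] commuting_before[OF assms(2) 1(1)] assms by auto
qed

lemma commuting_trans_sym: "u \<sim> u1 \<Longrightarrow> u \<sim> u2 \<Longrightarrow> u1 \<sim> u2"
  using sym_commuting by (meson symD rtrancl_trans)

text \<open>Under suitable orientations a common sum is directly followed by \<open>b\<close> in one
  member of a class and by \<open>c\<close> or \<open>d\<close>, as desired, in another. Then
  \<open>b\<close> is orthogonal to \<open>c\<close> and \<open>d\<close>, hence to
  \<open>a + b\<close>, against the product \<open>1 / 2\<close>.\<close>

lemma middle_middle:
  assumes "{a, b, a + b} \<in> contractible" "{c, d, c + d} \<in> contractible"
    "{a, b, a + b} \<noteq> {c, d, c + d}"
  shows "a + b \<noteq> c + d"
proof
  assume eq: "a + b = c + d"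
  have ne: "b \<noteq> c" "b \<noteq> d"
    using eq assms(3) by (auto simp: add.commute)
  have orth: "B b y = 0"
    if y: "{x, y, x + y} = {c, d, c + d}" "x + y = a + b" "y \<noteq> b" for x y
  proof -
    have T2: "{x, y, x + y} \<in> contractible" using assms(2) y by simp
    obtain u where u: "u \<in> exprs" "before (rs u) a b" "before (rs u) x y"
      using orient[OF assms(1) T2] assms(3) y by metis
    obtain u1 A C where u1: "u \<sim> u1" "rs u1 = A @ [a, a + b, b] @ C"
      using obtain_consecutive[OF u(1) assms(1) u(2)] .
    obtain u2 A' C' where u2: "u \<sim> u2" "rs u2 = A' @ [x, x + y, y] @ C'"
      using obtain_consecutive[OF u(1) T2 u(3)] .
    show ?thesis
      using successors_orthogonal[OF exprs_commuting[OF u(1) u1(1)] commuting_trans_sym[OF u1(1) u2(1)],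
          of "A @ [a]" "a + b" b C "A' @ [x]" y C']
        u1 u2 y contractible_form(8)[OF assms(1)] contractible_form(8)[OF T2]
        form_sym[of b "a + b"] form_sym[of y "a + b"] by simp
  qed
  have "{d, c, d + c} = {c, d, c + d}" "d + c = a + b"
    unfolding eq by (auto simp: add.commute)
  then have "B b d = 0" "B b c = 0"
    using orth[OF HOL.refl eq[symmetric]] orth[of d c] ne by blast+
  then have "B b (a + b) = 0" unfolding eq by (simp add: form_add_right)
  then show False using contractible_form(8)[OF assms(1)] by simp
qed

text \<open>If \<open>a = c + d\<close>, then \<open>a\<close> is directly followed by
  \<open>a + b\<close> as an outer root and by \<open>c\<close> or \<open>d\<close> as a middle one.
  This makes \<open>a + b\<close> orthogonal to \<open>c\<close> and \<open>d\<close>, hence to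
  \<open>a\<close>.\<close>

lemma end_middle:
  assumes "{a, b, a + b} \<in> contractible" "{c, d, c + d} \<in> contractible"
    "{a, b, a + b} \<noteq> {c, d, c + d}"
  shows "a \<noteq> c + d"
proof
  assume eq: "a = c + d"
  note f = contractible_form[OF assms(1)] and g = contractible_form[OF assms(2)]
  have ne: "c \<noteq> a + b" "d \<noteq> a + b"
  proof -
    show "c \<noteq> a + b" using roots_sum_neq(1)[OF g(2) f(2)] eq by (auto simp: add.assoc)
    show "d \<noteq> a + b"
      using roots_sum_neq(1)[OF g(1) f(2)] eq by (auto simp: add.assoc add.left_commute)
  qed
  have orth: "B (a + b) y = 0"
    if y: "{x, y, x + y} = {c, d, c + d}" "x + y = a" "y \<noteq> a + b" for x y
  proof -
    have T2: "{x, y, x + y} \<in> contractible" using assms(2) y by simp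
    obtain u where u: "u \<in> exprs" "before (rs u) a b" "before (rs u) x y"
      using orient[OF assms(1) T2] assms(3) y by metis
    obtain u1 A C where u1: "u \<sim> u1" "rs u1 = A @ [a, a + b, b] @ C"
      using obtain_consecutive[OF u(1) assms(1) u(2)] .
    obtain u2 A' C' where u2: "u \<sim> u2" "rs u2 = A' @ [x, x + y, y] @ C'"
      using obtain_consecutive[OF u(1) T2 u(3)] .
    show ?thesis
      using successors_orthogonal[OF exprs_commuting[OF u(1) u1(1)] commuting_trans_sym[OF u1(1) u2(1)],
          of A a "a + b" "b # C" "A' @ [x]" y C']
        u1 u2 y f(7) contractible_form(8)[OF T2] form_sym[of y a] by simp
  qed
  have "{d, c, d + c} = {c, d, c + d}" "d + c = a"
    unfolding eq by (auto simp: add.commute)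
  then have "B (a + b) d = 0" "B (a + b) c = 0"
    using orth[OF HOL.refl eq[symmetric]] orth[of d c] ne by blast+
  then have "B (a + b) (c + d) = 0" by (simp add: form_add_right)
  then have "B (a + b) a = 0" unfolding eq .
  then show False using f(7) form_sym[of a "a + b"] by simp
qed

text \<open>The successors \<open>a + b\<close> and \<open>a + d\<close> of the common outer root
  are orthogonal, and so are \<open>b\<close> and \<open>a + d\<close>; subtracting contradicts
  \<open>B a (a + d) = 1 / 2\<close>.\<close>

lemma end_end:
  assumes "{a, b, a + b} \<in> contractible" "{a, d, a + d} \<in> contractible"
  shows "b = d"
proof (rule ccontr)
  assume bd: "b \<noteq> d"
  note f = contractible_form[OF assms(1)] and g = contractible_form[OF assms(2)]
  have "{a, b, a + b} \<noteq> {a, d, a + d}"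
  proof
    assume "{a, b, a + b} = {a, d, a + d}"
    then have "d \<in> {a, b, a + b}" "a + d \<in> {a, b, a + b}" by blast+
    then show False using triple_pair[OF assms(1), of a d] bd f(5) by auto
  qed
  then obtain u where u: "u \<in> exprs" "before (rs u) a b" "before (rs u) a d"
    using orient[OF assms] by blast
  obtain u1 A C where u1: "u \<sim> u1" "rs u1 = A @ [a, a + b, b] @ C"
    using obtain_consecutive[OF u(1) assms(1) u(2)] .
  obtain u2 A' C' where u2: "u \<sim> u2" "rs u2 = A' @ [a, a + d, d] @ C'"
    using obtain_consecutive[OF u(1) assms(2) u(3)] .
  note ex1 = exprs_commuting[OF u(1) u1(1)] and ex2 = exprs_commuting[OF u(1) u2(1)]
  note u12 = commuting_trans_sym[OF u1(1) u2(1)] and u21 = commuting_trans_sym[OF u2(1) u1(1)]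
  have sum0: "B (a + b) (a + d) = 0"
    using successors_orthogonal[OF ex1 u12, of A a "a + b" "b # C" A' "a + d" "d # C'"]
      u1(2) u2(2) f(7) g(7) bd by simp
  have neb: "a + d \<noteq> b"
    using f(6) g(7) by auto
  \<comment> \<open>Since \<open>a, a + b, b\<close> is consecutive in \<open>u1\<close>, the root
    \<open>a + d\<close> comes after \<open>b\<close> there; in \<open>u2\<close> it directly
    follows \<open>a\<close> and so precedes \<open>b\<close>.\<close>
  have "B b (a + d) = 0"
  proof (rule reversed_orthogonal[OF ex1 u12])
    have "before (rs u2) a (a + d)" unfolding u2(2) by (simp add: before_append)
    then have 1: "before (rs u1) a (a + d)" using commuting_before[OF u21] g(7) by simp
    then have 2: "before (rs u1) (a + b) (a + d)"
      using before_next[OF exprsD(2)[OF ex1], of A a "a + b" "b # C"] u1(2) bd by simp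
    show "before (rs u1) b (a + d)"
      using before_next[OF exprsD(2)[OF ex1], of "A @ [a]" "a + b" b C, OF _ 2] u1(2) neb by simp
    have "before (rs u1) a b" unfolding u1(2) by (simp add: before_append)
    then have "before (rs u2) a b" using commuting_before[OF u12] f(6) by simp
    then show "before (rs u2) (a + d) b"
      using before_next[OF exprsD(2)[OF ex2], of A' a "a + d" "d # C'"] u2(2) neb by simp
  qed
  then have "B a (a + d) = 0" using sum0 by (simp add: coxeter_form_add_left)
  then show False using g(7) by simp
qed

text \<open>Up to swapping \<open>a\<close> and \<open>b\<close>, a common root is in each triple
  either the first outer root or the sum; the three preceding lemmas exclude every
  combination.\<close>

lemma contractible_disjoint: "pairwise disjnt contractible"
proof (intro pairwiseI)
  fix T T' assume T: "T \<in> contractible" "T' \<in> contractible" "T \<noteq> T'"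
  show "disjnt T T'"
  proof (rule ccontr)
    assume "\<not> disjnt T T'"
    then obtain t where t: "t \<in> T" "t \<in> T'" by (auto simp: disjnt_iff)
    have cases: "(\<exists>a b. X = {a, b, a + b} \<and> t = a) \<or> (\<exists>a b. X = {a, b, a + b} \<and> t = a + b)"
      if "X \<in> contractible" "t \<in> X" for X
    proof -
      obtain a b where X: "X = {a, b, a + b}" using \<open>X \<in> contractible\<close> by (rule contractible_cases)
      then have "X = {b, a, b + a}" by (auto simp: add.commute)
      with X that(2) show ?thesis by blast
    qed
    show False
      using cases[OF T(1) t(1)] cases[OF T(2) t(2)] T middle_middle end_middle end_end by metis
  qed
qed

end

section \<open>Inversion sets of group elements\<close>

context coxeter_group
begin

lemma word_val_closed [simp]: "word_val W s u \<in> carrier W"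
  by (induction u) (auto simp: word_val_def gen_closed)

lemma word_val_append: "word_val W s (u @ v) = word_val W s u \<otimes> word_val W s v"
proof (induction u)
  case Nil
  then show ?case using word_val_closed[of v] by (simp add: word_val_def)
next
  case (Cons i u)
  then show ?case
    using word_val_closed[of u] word_val_closed[of v] gen_closed[of i]
    by (simp add: word_val_def m_assoc)
qed

lemma inv_word_val:
  assumes "simply_laced m"
  shows "inv (word_val W s u) = word_val W s (rev u)"
proof (rule inv_equality)
  interpret simply_laced_matrix m
    using matrix assms by unfold_locales
  have "rev u @ u \<approx> []"
  proof (induction u)
    case (Cons i u)
    then show ?case using cong_cancel_letter[of "rev u" i u] coxeter_cong.trans by auto
  qed (simp add: coxeter_cong.refl)
  then have "word_val W s (rev u @ u) = word_val W s []" using presented by blast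
  then show "word_val W s (rev u) \<otimes> word_val W s u = \<one>"
    unfolding word_val_append by (simp add: word_val_def[of W s "[]"])
qed auto

text \<open>Applying \<open>u\<close> turns membership in the image of the negative roots under the
  inverse into the sign condition of \<open>set_rs\<close>.\<close>

lemma inversion_set_word_val:
  assumes "simply_laced m" "simply_laced_matrix.reduced m u"
  shows "inversion_set W s m (word_val W s u) = set (root_sequence m u)"
proof -
  interpret simply_laced_matrix m
    using matrix assms(1) by unfold_locales
  have cg: "coxeter_group W s m" by unfold_locales
  have "roots W s m = {x. root x}"
    unfolding roots_def root_def
    using generated act_word_val[OF cg assms(1)] word_val_closed by (auto; metis)
  then have pos: "pos_roots W s m = {x. root x \<and> nonneg x}"
    by (auto simp: pos_roots_def nonneg_def)
  have neg: "neg_roots W s m = {x. root x \<and> nonneg (- x)}"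
  proof (intro equalityI subsetI)
    fix x assume "x \<in> {x. root x \<and> nonneg (- x)}"
    then have "- x \<in> pos_roots W s m" by (simp add: pos root_uminus)
    then show "x \<in> neg_roots W s m" unfolding neg_roots_def by force
  qed (auto simp: neg_roots_def pos root_uminus)
  have act: "act W s m (inv (word_val W s u)) = word_act m (rev u)"
    by (simp add: inv_word_val[OF assms(1)] act_word_val[OF cg assms(1)])
  have "x \<in> word_act m (rev u) ` neg_roots W s m \<longleftrightarrow> word_act m u x \<in> neg_roots W s m" for x
    by (auto intro!: image_eqI[of x _ "word_act m u x"])
  then show ?thesis
    unfolding inversion_set_def act set_rs[OF assms(2)] pos
    by (auto simp: neg root_act_iff)
qed

end

theorem theorem2p2p1:
  fixes W :: "('g, 'b) monoid_scheme"
    and s :: "'i \<Rightarrow> 'g"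
    and m :: "'i \<Rightarrow> 'i \<Rightarrow> nat"
    and w :: 'g
  assumes "coxeter_group W s m"
    and "simply_laced m"
    and "w \<in> carrier W"
    and "card (commutation_classes W s m w) = 2 ^ num_contractible W s m w"
  shows "freely_braided W s m w"
proof -
  interpret coxeter_group W s m by fact
  interpret simply_laced_matrix m
    using matrix assms(2) by unfold_locales
  obtain u where "word_val W s u = w" using generated assms(3) by blast
  \<comment> \<open>A reduced word for \<open>w\<close> serves as the reference word for
    orientations.\<close>
  then obtain e where e: "word_val W s e = w" "reduced e"
    using obtain_reduced[of u] presented by metis
  interpret reduced_word m e
    by unfold_locales (rule e(2))
  have exprs: "reduced_expressions W s w = exprs"
    unfolding reduced_expressions_def exprs_def reduced_iff e(1)[symmetric]
    using presented by (metis (no_types, lifting))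
  have contractible: "contractible_triples W s m w = contractible"
    using inversion_set_word_val[OF assms(2) e(2)]
    unfolding contractible_triples_def inversion_triples_def root_sequences_def exprs e(1)
      contractible_def consecutive_def by auto
  interpret extremal_word m e
    using assms(4) unfolding commutation_classes_def num_contractible_def exprs contractible
    by unfold_locales
  show ?thesis
    unfolding freely_braided_def contractible by (rule contractible_disjoint)
qed

end
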